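(* Let $\mathbb Z\langle X\rangle$ be the free unital associative ring on the countably infinite set $X=\{x_1,x_2,\dots\}$. Let $T^{(4)}$ be the two-sided ideal generated by all $[a_1,a_2,a_3,a_4]$, and let $T^{(3,2)}$ be the two-sided ideal generated by all $[a_1,a_2,a_3,a_4]$ and all $[a_1,a_2][a_3,a_4,a_5]$ ($a_i\in\mathbb Z\langle X\rangle$). Let \[\mathcal E=\{x_{j_1}\cdots x_{j_l}[x_{i_1},x_{i_2}]\cdots[x_{i_{2k-1}},x_{i_{2k}}][x_{i_{2k+1}},x_{i_{2k+2}},x_{i_{2k+3}}] \mid l\ge0,\ k\ge1,\ j_1\le\dots\le j_l,\ i_1<i_2<\dots<i_{2k+3}\}.\] Then $T^{(3,2)}/T^{(4)}$ is an elementary abelian $3$-group and $\{e+T^{(4)}\mid e\in\mathcal E\}$ is a basis of it over $\mathbb F_3=\mathbb Z/3\mathbb Z$.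
   Context: Commutators are left-normed: $[a,b]=ab-ba$, $[a_1,\dots,a_n]=[[a_1,\dots,a_{n-1}],a_n]$. For $l=0$ the monomial prefix is empty (equal to $1$). *)

theory Defs
  imports Main
begin

text \<open>The free unital associative ring Z<X> on X = {x_0, x_1, ...} (indexed by nat),
  realised as the finitely supported functions from words (nat list) to int.\<close>

type_synonym fr = "nat list \<Rightarrow> int"

definition FA :: "fr set" where
  "FA = {f. finite {w. f w \<noteq> 0}}"

definition fzero :: fr where "fzero = (\<lambda>w. 0)"
definition fone :: fr where "fone = (\<lambda>w. if w = [] then 1 else 0)"
definition fvar :: "nat \<Rightarrow> fr" where "fvar i = (\<lambda>w. if w = [i] then 1 else 0)"
definition fadd :: "fr \<Rightarrow> fr \<Rightarrow> fr" where "fadd f g = (\<lambda>w. f w + g w)"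
definition fneg :: "fr \<Rightarrow> fr" where "fneg f = (\<lambda>w. - f w)"
definition fsub :: "fr \<Rightarrow> fr \<Rightarrow> fr" where "fsub f g = (\<lambda>w. f w - g w)"
definition fsmul :: "int \<Rightarrow> fr \<Rightarrow> fr" where "fsmul c f = (\<lambda>w. c * f w)"

text \<open>Multiplication: concatenation of words, extended bilinearly.\<close>
definition fmul :: "fr \<Rightarrow> fr \<Rightarrow> fr" where
  "fmul f g = (\<lambda>w. \<Sum>i\<le>length w. f (take i w) * g (drop i w))"

fun fprod :: "fr list \<Rightarrow> fr" where
  "fprod [] = fone"
| "fprod (a # as) = fmul a (fprod as)"

definition comm :: "fr \<Rightarrow> fr \<Rightarrow> fr" where
  "comm a b = fsub (fmul a b) (fmul b a)"
definition comm3 :: "fr \<Rightarrow> fr \<Rightarrow> fr \<Rightarrow> fr" where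
  "comm3 a b c = comm (comm a b) c"
definition comm4 :: "fr \<Rightarrow> fr \<Rightarrow> fr \<Rightarrow> fr \<Rightarrow> fr" where
  "comm4 a b c d = comm (comm3 a b c) d"

inductive_set ideal_gen :: "fr set \<Rightarrow> fr set" for S :: "fr set" where
  gen: "s \<in> S \<Longrightarrow> s \<in> ideal_gen S"
| zero: "fzero \<in> ideal_gen S"
| add: "x \<in> ideal_gen S \<Longrightarrow> y \<in> ideal_gen S \<Longrightarrow> fadd x y \<in> ideal_gen S"
| neg: "x \<in> ideal_gen S \<Longrightarrow> fneg x \<in> ideal_gen S"
| lmul: "a \<in> FA \<Longrightarrow> x \<in> ideal_gen S \<Longrightarrow> fmul a x \<in> ideal_gen S"
| rmul: "a \<in> FA \<Longrightarrow> x \<in> ideal_gen S \<Longrightarrow> fmul x a \<in> ideal_gen S"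

definition T4 :: "fr set" where
  "T4 = ideal_gen {comm4 a1 a2 a3 a4 | a1 a2 a3 a4. a1 \<in> FA \<and> a2 \<in> FA \<and> a3 \<in> FA \<and> a4 \<in> FA}"

definition T32 :: "fr set" where
  "T32 = ideal_gen ({comm4 a1 a2 a3 a4 | a1 a2 a3 a4.
                       a1 \<in> FA \<and> a2 \<in> FA \<and> a3 \<in> FA \<and> a4 \<in> FA}
                   \<union> {fmul (comm a1 a2) (comm3 a3 a4 a5) | a1 a2 a3 a4 a5.
                       a1 \<in> FA \<and> a2 \<in> FA \<and> a3 \<in> FA \<and> a4 \<in> FA \<and> a5 \<in> FA})"

text \<open>The element x_{j_1}...x_{j_l}[x_{i_1},x_{i_2}]...[x_{i_{2k-1}},x_{i_{2k}}][x_{i_{2k+1}},x_{i_{2k+2}},x_{i_{2k+3}}]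
  (indices of the list is are 0-based).\<close>
definition Eelt :: "nat list \<Rightarrow> nat \<Rightarrow> nat list \<Rightarrow> fr" where
  "Eelt js k is = fmul (fprod (map fvar js))
      (fmul (fprod (map (\<lambda>t. comm (fvar (is ! (2*t))) (fvar (is ! (2*t+1)))) [0..<k]))
            (comm3 (fvar (is ! (2*k))) (fvar (is ! (2*k+1))) (fvar (is ! (2*k+2)))))"

definition Eset :: "fr set" where
  "Eset = {Eelt js k is | js k is. k \<ge> 1 \<and> sorted js \<and> length is = 2*k+3 \<and> sorted_wrt (<) is}"

definition lincomb :: "fr set \<Rightarrow> (fr \<Rightarrow> int) \<Rightarrow> fr" where
  "lincomb F c = (\<lambda>w. \<Sum>e\<in>F. c e * e w)"

end

theory Submission
  imports Defs "HOL-Library.Multiset" "HOL-Library.Numeral_Type" "HOL-Library.Function_Algebras"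
begin

text \<open>
  Spanning. In the quotient by \<^term>\<open>T4\<close> triple commutators are central. Applying this to the products
  \<open>[a, b, cd]\<close> and \<open>[ab, c, d]\<close> shows that \<open>[a, b, c][d, e]\<close> is skew symmetric in all five arguments;
  the Jacobi identity then says that it is killed by 3. Consequently products of commutators
  ending in a triple commutator are skew symmetric in all arguments, and the prefix can be sorted
  because commutators are central modulo triple commutators, which annihilate such products.

  Independence. Let \<open>e\<^sub>i\<close> and \<open>z\<close> be anticommuting odd variables over the field with three elements.
  There are operators \<open>X\<^sub>i\<close> and \<open>\<Phi>\<close> on polynomials with Grassmann coefficients that commute with the
  \<open>e\<^sub>i\<close> and \<open>z\<close> and satisfy \<open>[X\<^sub>a, X\<^sub>b] = e\<^sub>a e\<^sub>b \<Phi>\<close> and \<open>[\<Phi>, X\<^sub>c] = e\<^sub>c z\<close> with \<open>z \<Phi> = z\<close>; the Jacobi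
  identity holds for these relations because \<open>3 e\<^sub>a e\<^sub>b e\<^sub>c z = 0\<close>. For the odd derivation \<open>D\<close> with
  \<open>D X\<^sub>i = e\<^sub>i\<close>, a triple commutator of polynomials in the \<open>X\<^sub>i\<close> equals \<open>D(u) D(v) D(w) z\<close>, which is
  central, so \<^term>\<open>T4\<close> acts as zero, whereas the elements of \<^term>\<open>Eset\<close> map the vacuum vector to pairwise
  distinct basis vectors, up to sign.
\<close>

section \<open>The free ring\<close>

lemma fmul_Nil: "fmul f g [] = f [] * g []"
  by (simp add: fmul_def)

text \<open>Isolating the empty prefix turns the convolution into a recursion in which only the left
  factor changes, so the ring laws become inductions on the word with \<open>f\<close>
  arbitrary.\<close>

lemma fmul_Cons: "fmul f g (x # w) = f [] * g (x # w) + fmul (\<lambda>u. f (x # u)) g w"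
  unfolding fmul_def by (simp add: sum.atMost_Suc_shift del: sum.atMost_Suc)

lemma fmul_fadd_left: "fmul (fadd f g) h = fadd (fmul f h) (fmul g h)"
  by (simp add: fmul_def fadd_def sum.distrib algebra_simps)

lemma fmul_fadd_right: "fmul f (fadd g h) = fadd (fmul f g) (fmul f h)"
  by (simp add: fmul_def fadd_def sum.distrib algebra_simps)

lemma fmul_fsmul_left: "fmul (\<lambda>w. c * f w) h w = c * fmul f h w"
  by (simp add: fmul_def sum_distrib_left algebra_simps)

lemma fmul_assoc: "fmul (fmul f g) h = fmul f (fmul g h)"
proof
  fix w show "fmul (fmul f g) h w = fmul f (fmul g h) w"
  proof (induction w arbitrary: f)
    case Nil
    show ?case by (simp add: fmul_Nil)
  next
    case (Cons x w)
    have "fmul (\<lambda>u. fmul f g (x # u)) h w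
      = fmul (fadd (\<lambda>u. f [] * g (x # u)) (fmul (\<lambda>u. f (x # u)) g)) h w"
      by (simp add: fmul_Cons fadd_def)
    also have "\<dots> = f [] * fmul (\<lambda>u. g (x # u)) h w + fmul (\<lambda>u. f (x # u)) (fmul g h) w"
      by (simp add: fmul_fadd_left fmul_fsmul_left Cons.IH) (simp add: fadd_def fmul_fsmul_left Cons.IH)
    finally show ?case by (simp add: fmul_Cons fmul_Nil algebra_simps)
  qed
qed

lemma fmul_fone_left: "fmul fone f = f"
proof
  fix w show "fmul fone f w = f w"
    by (cases w) (simp_all add: fmul_Nil fmul_Cons fone_def, simp add: fmul_def)
qed

lemma fmul_fone_right: "fmul f fone = f"
proof
  fix w show "fmul f fone w = f w"
    by (induction w arbitrary: f) (simp_all add: fmul_Nil fmul_Cons, simp_all add: fone_def)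
qed

definition fmon :: "int \<Rightarrow> nat list \<Rightarrow> fr" where
  "fmon c u = (\<lambda>w. if w = u then c else 0)"

lemma fmul_fmon: "fmul (fmon c u) (fmon d v) = fmon (c * d) (u @ v)"
proof
  fix w show "fmul (fmon c u) (fmon d v) w = fmon (c * d) (u @ v) w"
  proof (induction w arbitrary: c u)
    case Nil
    show ?case by (auto simp: fmul_Nil fmon_def)
  next
    case (Cons x w)
    show ?case
    proof (cases u)
      case Nil
      have "(\<lambda>z. fmon c [] (x # z)) = fzero" by (simp add: fmon_def fzero_def)
      then show ?thesis
        by (simp add: fmul_Cons Nil) (auto simp: fmon_def fmul_def fzero_def)
    next
      case (Cons y us)
      have "(\<lambda>z. fmon c (y # us) (x # z)) = fmon (if x = y then c else 0) us"
        by (auto simp: fmon_def)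
      moreover have "fmon c (y # us) [] = 0" by (simp add: fmon_def)
      ultimately show ?thesis
        using Cons.IH[of "if x = y then c else 0" us]
        by (simp only: fmul_Cons Cons) (simp add: fmon_def)
    qed
  qed
qed

lemma fmon_in_FA [simp]: "fmon c u \<in> FA"
proof -
  have "{w. fmon c u w \<noteq> 0} \<subseteq> {u}" by (auto simp: fmon_def)
  then show ?thesis unfolding FA_def by (simp add: finite_subset)
qed

lemma fvar_eq_fmon: "fvar i = fmon 1 [i]"
  by (simp add: fvar_def fmon_def)

lemma fone_eq_fmon: "fone = fmon 1 []"
  by (simp add: fone_def fmon_def)

lemma fzero_in_FA [simp]: "fzero \<in> FA"
  by (simp add: FA_def fzero_def)

lemma fone_in_FA [simp]: "fone \<in> FA"
  by (simp add: fone_eq_fmon)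

lemma fvar_in_FA [simp]: "fvar i \<in> FA"
  by (simp add: fvar_eq_fmon)

lemma fadd_in_FA [simp]: "f \<in> FA \<Longrightarrow> g \<in> FA \<Longrightarrow> fadd f g \<in> FA"
  unfolding FA_def fadd_def
  by (auto intro!: finite_subset[of "{w. f w + g w \<noteq> 0}" "{w. f w \<noteq> 0} \<union> {w. g w \<noteq> 0}"])

lemma fneg_in_FA [simp]: "f \<in> FA \<Longrightarrow> fneg f \<in> FA"
  by (simp add: FA_def fneg_def)

lemma fsub_eq: "fsub f g = fadd f (fneg g)"
  by (simp add: fsub_def fadd_def fneg_def)

lemma fsub_in_FA [simp]: "f \<in> FA \<Longrightarrow> g \<in> FA \<Longrightarrow> fsub f g \<in> FA"
  by (simp add: fsub_eq)

lemma FA_induct [consumes 1, case_names zero add]: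
  assumes "f \<in> FA" and zero: "P fzero"
    and add: "\<And>c u g. g \<in> FA \<Longrightarrow> P g \<Longrightarrow> P (fadd (fmon c u) g)"
  shows "P f"
proof -
  \<comment> \<open>Inducting over a finite superset \<open>S\<close> of the support lets the step
    delete \<open>u\<close> whether or not \<open>f u\<close> is zero.\<close>
  have "finite S \<Longrightarrow> {w. f w \<noteq> 0} \<subseteq> S \<Longrightarrow> f \<in> FA \<and> P f" for S
  proof (induction S arbitrary: f rule: finite_induct)
    case empty
    then have "f = fzero" by (auto simp: fzero_def)
    then show ?case using zero by simp
  next
    case (insert u S)
    have g: "f(u := 0) \<in> FA \<and> P (f(u := 0))" by (rule insert.IH) (use insert.prems in auto)
    have "f = fadd (fmon (f u) u) (f(u := 0))" by (auto simp: fadd_def fmon_def)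
    with g add[of "f(u := 0)" "f u" u] show ?case by (metis fadd_in_FA fmon_in_FA)
  qed
  with \<open>f \<in> FA\<close> show ?thesis unfolding FA_def by blast
qed

lemma fmul_fzero [simp]: "fmul f fzero = fzero" "fmul fzero f = fzero"
  by (simp_all add: fmul_def fzero_def)

lemma fadd_fzero [simp]: "fadd f fzero = f" "fadd fzero f = f"
  by (simp_all add: fadd_def fzero_def)

lemma fmul_in_FA [simp]:
  assumes "f \<in> FA" "g \<in> FA"
  shows "fmul f g \<in> FA"
proof -
  have "fmul (fmon c u) g \<in> FA" for c u
    using assms(2) by (induction rule: FA_induct) (simp_all add: fmul_fadd_right fmul_fmon)
  with assms(1) show ?thesis
    by (induction rule: FA_induct) (simp_all add: fmul_fadd_left)
qed

lemma comm_in_FA [simp]: "f \<in> FA \<Longrightarrow> g \<in> FA \<Longrightarrow> comm f g \<in> FA"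
  by (simp add: comm_def)

lemma comm3_in_FA [simp]: "f \<in> FA \<Longrightarrow> g \<in> FA \<Longrightarrow> h \<in> FA \<Longrightarrow> comm3 f g h \<in> FA"
  by (simp add: comm3_def)

lemma comm4_in_FA [simp]: "f \<in> FA \<Longrightarrow> g \<in> FA \<Longrightarrow> h \<in> FA \<Longrightarrow> k \<in> FA \<Longrightarrow> comm4 f g h k \<in> FA"
  by (simp add: comm4_def)

lemma fprod_in_FA [simp]: "set fs \<subseteq> FA \<Longrightarrow> fprod fs \<in> FA"
  by (induction fs) simp_all

lemma Eelt_in_FA [simp]: "Eelt js k is \<in> FA"
  unfolding Eelt_def by (intro fmul_in_FA fprod_in_FA comm3_in_FA) auto

lemma ideal_gen_subset_FA:
  assumes "S \<subseteq> FA" shows "ideal_gen S \<subseteq> FA"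
proof
  show "x \<in> FA" if "x \<in> ideal_gen S" for x
    using that by (induction rule: ideal_gen.induct) (use assms in auto)
qed

lemma T32_subset_FA: "T32 \<subseteq> FA"
  unfolding T32_def by (rule ideal_gen_subset_FA) auto

lemma ideal_gen_mono:
  assumes "S \<subseteq> S'" shows "ideal_gen S \<subseteq> ideal_gen S'"
proof
  show "x \<in> ideal_gen S'" if "x \<in> ideal_gen S" for x
    using that
  proof (induction rule: ideal_gen.induct)
    case (gen s)
    with assms show ?case by (blast intro: ideal_gen.gen)
  qed (simp_all add: ideal_gen.zero ideal_gen.add ideal_gen.neg ideal_gen.lmul ideal_gen.rmul)
qed

lemma T4_subset_T32: "T4 \<subseteq> T32"
  unfolding T4_def T32_def by (rule ideal_gen_mono) simp

lemma fprod_append: "fprod (fs @ gs) = fmul (fprod fs) (fprod gs)"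
  by (induction fs) (simp_all add: fmul_fone_left fmul_assoc)

lemma Eset_subset_FA: "Eset \<subseteq> FA"
  by (auto simp: Eset_def)

lemma Eset_subset_T32: "Eset \<subseteq> T32"
proof
  fix e assume "e \<in> Eset"
  then obtain js k "is" where e: "e = Eelt js k is" and k: "k \<ge> 1"
    by (auto simp: Eset_def)
  \<comment> \<open>As \<open>k\<close> is positive, the last pair and the triple commutator form a
    generator of \<open>T32\<close>; the other factors multiply it from the left.\<close>
  obtain n where n: "k = Suc n" using k by (cases k) auto
  let ?c = "\<lambda>t. comm (fvar (is ! (2*t))) (fvar (is ! (2*t+1)))"
  let ?t = "comm3 (fvar (is ! (2*k))) (fvar (is ! (2*k+1))) (fvar (is ! (2*k+2)))"
  have "fmul (?c n) ?t \<in> T32"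
    unfolding T32_def by (rule ideal_gen.gen) (use fvar_in_FA in blast)
  then have "fmul (fprod (map fvar js)) (fmul (fprod (map ?c [0..<n])) (fmul (?c n) ?t)) \<in> T32"
    unfolding T32_def by (rule ideal_gen.lmul[rotated, OF ideal_gen.lmul[rotated]]) (auto intro!: fprod_in_FA)
  then show "e \<in> T32"
    unfolding e Eelt_def by (simp add: n fprod_append fmul_assoc fmul_fone_right)
qed

section \<open>Commutator products and ring homomorphisms from the free ring\<close>

definition br :: "'a::ring_1 \<Rightarrow> 'a \<Rightarrow> 'a" where
  "br a b = a * b - b * a"

text \<open>Recursion by two entries matches the grouping into pairs closed by a triple commutator.
  Lists of even length or with fewer than three entries get the junk value 0.\<close>

fun comm_prod :: "'a::ring_1 list \<Rightarrow> 'a" where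
  "comm_prod [a, b, c] = br (br a b) c"
| "comm_prod (a # b # c # d # l) = br a b * comm_prod (c # d # l)"
| "comm_prod l = 0"

text \<open>Shared by the quotient map modulo \<open>T4\<close> and the evaluation in the model. The
  laws are restricted to \<open>FA\<close> because \<open>fr\<close> also contains functions of
  infinite support.\<close>

locale fa_hom =
  fixes \<rho> :: "fr \<Rightarrow> 'a::ring_1"
  assumes hom_add: "f \<in> FA \<Longrightarrow> g \<in> FA \<Longrightarrow> \<rho> (fadd f g) = \<rho> f + \<rho> g"
    and hom_mul: "f \<in> FA \<Longrightarrow> g \<in> FA \<Longrightarrow> \<rho> (fmul f g) = \<rho> f * \<rho> g"
    and hom_one: "\<rho> fone = 1"
begin

lemma hom_zero: "\<rho> fzero = 0"
  using hom_add[of fzero fzero] by simp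

lemma hom_neg: "f \<in> FA \<Longrightarrow> \<rho> (fneg f) = - \<rho> f"
proof -
  assume f: "f \<in> FA"
  have "fadd f (fneg f) = fzero" by (simp add: fadd_def fneg_def fzero_def)
  with hom_add[OF f fneg_in_FA[OF f]] hom_zero show ?thesis
    by (simp add: eq_neg_iff_add_eq_0 add.commute)
qed

lemma hom_sub: "f \<in> FA \<Longrightarrow> g \<in> FA \<Longrightarrow> \<rho> (fsub f g) = \<rho> f - \<rho> g"
  by (simp add: fsub_eq hom_add hom_neg)

lemma hom_comm: "f \<in> FA \<Longrightarrow> g \<in> FA \<Longrightarrow> \<rho> (comm f g) = br (\<rho> f) (\<rho> g)"
  by (simp add: comm_def br_def hom_sub hom_mul)

lemma hom_comm3:
  "f \<in> FA \<Longrightarrow> g \<in> FA \<Longrightarrow> h \<in> FA \<Longrightarrow> \<rho> (comm3 f g h) = br (br (\<rho> f) (\<rho> g)) (\<rho> h)"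
  by (simp add: comm3_def hom_comm)

lemma hom_comm4:
  "f \<in> FA \<Longrightarrow> g \<in> FA \<Longrightarrow> h \<in> FA \<Longrightarrow> k \<in> FA \<Longrightarrow>
    \<rho> (comm4 f g h k) = br (br (br (\<rho> f) (\<rho> g)) (\<rho> h)) (\<rho> k)"
  by (simp add: comm4_def hom_comm hom_comm3)

lemma hom_fprod: "set fs \<subseteq> FA \<Longrightarrow> \<rho> (fprod fs) = prod_list (map \<rho> fs)"
  by (induction fs) (simp_all add: hom_one hom_mul)

lemma hom_smul: "f \<in> FA \<Longrightarrow> \<rho> (fsmul c f) = of_int c * \<rho> f \<and> fsmul c f \<in> FA"
proof (induction c rule: int_induct[where k = 0])
  case base
  have "fsmul 0 f = fzero" by (simp add: fsmul_def fzero_def)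
  then show ?case by (simp add: hom_zero)
next
  case (step1 i)
  have "fsmul (i + 1) f = fadd (fsmul i f) f" by (simp add: fsmul_def fadd_def algebra_simps)
  with step1 show ?case by (simp add: hom_add algebra_simps)
next
  case (step2 i)
  have "fsmul (i - 1) f = fsub (fsmul i f) f" by (simp add: fsmul_def fsub_def algebra_simps)
  with step2 show ?case by (simp add: hom_sub algebra_simps)
qed

lemma hom_lincomb:
  "finite F \<Longrightarrow> F \<subseteq> FA \<Longrightarrow> \<rho> (lincomb F c) = (\<Sum>e\<in>F. of_int (c e) * \<rho> e) \<and> lincomb F c \<in> FA"
proof (induction F rule: finite_induct)
  case empty
  have "lincomb {} c = fzero" by (simp add: lincomb_def fzero_def)
  then show ?case by (simp add: hom_zero)
next
  case (insert x F)
  have "lincomb (insert x F) c = fadd (fsmul (c x) x) (lincomb F c)"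
    using insert.hyps by (simp add: lincomb_def fadd_def fsmul_def)
  then show ?case using insert by (simp add: hom_add hom_smul)
qed

lemma hom_comm_prod:
  "length is = 2 * k + 3 \<Longrightarrow>
    \<rho> (fmul (fprod (map (\<lambda>t. comm (fvar (is ! (2*t))) (fvar (is ! (2*t+1)))) [0..<k]))
            (comm3 (fvar (is ! (2*k))) (fvar (is ! (2*k+1))) (fvar (is ! (2*k+2)))))
    = comm_prod (map (\<lambda>i. \<rho> (fvar i)) is)"
proof (induction k arbitrary: "is")
  case 0
  then obtain a b c where "is = [a, b, c]"
    by (auto simp: length_Suc_conv numeral_eq_Suc)
  then show ?case by (simp add: fmul_fone_left hom_comm3)
next
  case (Suc k)
  then obtain a b c d l where l: "is = a # b # c # d # l"
    by (auto simp: length_Suc_conv numeral_eq_Suc)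
  \<comment> \<open>Removing the factor \<open>t = 0\<close> shifts the counters by one, hence the
    list indices by two, which corresponds to dropping \<open>a\<close> and
    \<open>b\<close>.\<close>
  have up: "[0..<Suc k] = 0 # map Suc [0..<k]"
    by (simp add: map_Suc_upt upt_conv_Cons del: upt_Suc)
  have len: "length (c # d # l) = 2 * k + 3" using Suc.prems l by simp
  have "\<rho> (fmul (fprod (map (\<lambda>t. comm (fvar (is ! (2*t))) (fvar (is ! (2*t+1)))) [0..<Suc k]))
            (comm3 (fvar (is ! (2*Suc k))) (fvar (is ! (2*Suc k+1))) (fvar (is ! (2*Suc k+2)))))
     = \<rho> (fmul (comm (fvar a) (fvar b))
        (fmul (fprod (map (\<lambda>t. comm (fvar ((c # d # l) ! (2*t))) (fvar ((c # d # l) ! (2*t+1)))) [0..<k]))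
            (comm3 (fvar ((c # d # l) ! (2*k))) (fvar ((c # d # l) ! (2*k+1))) (fvar ((c # d # l) ! (2*k+2))))))"
    unfolding up by (simp add: l fmul_assoc comp_def)
  also have "\<dots> = br (\<rho> (fvar a)) (\<rho> (fvar b)) * comm_prod (map (\<lambda>i. \<rho> (fvar i)) (c # d # l))"
    by (subst hom_mul, simp, intro fmul_in_FA fprod_in_FA comm3_in_FA, auto simp: hom_comm Suc.IH[OF len, simplified])
  finally show ?case by (simp add: l)
qed

lemma hom_Eelt:
  assumes "length is = 2 * k + 3"
  shows "\<rho> (Eelt js k is)
    = prod_list (map (\<lambda>i. \<rho> (fvar i)) js) * comm_prod (map (\<lambda>i. \<rho> (fvar i)) is)"
proof -
  have js: "set (map fvar js) \<subseteq> FA" by auto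
  show ?thesis
    unfolding Eelt_def
    by (subst hom_mul, rule fprod_in_FA[OF js], intro fmul_in_FA fprod_in_FA comm3_in_FA)
      (auto simp: hom_comm_prod[OF assms, simplified] hom_fprod[OF js] comp_def)
qed

end

section \<open>Rings with central triple commutators\<close>

lemma br_mult_left: "br (x * y) z = x * br y z + br x z * y"
  and br_mult_right: "br z (x * y) = br z x * y + x * br z y"
  and br_add_left: "br (x + y) z = br x z + br y z"
  and br_minus_left: "br (- x) z = - br x z"
  and br_skew: "br x z = - br z x"
  by (simp_all add: br_def algebra_simps)

lemma br_eq_0_iff: "br x y = 0 \<longleftrightarrow> x * y = y * x"
  by (simp add: br_def)

lemma three_times: "3 * x = x + x + (x::'a::ring_1)"
proof -
  have "(3::'a) = 1 + 1 + 1" by simp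
  then show ?thesis by (simp only: distrib_right mult_1_left)
qed

text \<open>Insertion sort is a chain of adjacent exchanges. \<open>R\<close> will be equality up to
  sign for commutator arguments, and congruence modulo the span for prefix letters.\<close>

lemma sort_related:
  fixes F :: "nat list \<Rightarrow> 'a"
  assumes refl: "\<And>x. R x x" and trans: "\<And>x y z. R x y \<Longrightarrow> R y z \<Longrightarrow> R x z"
    and swap: "\<And>l a b m. length (l @ a # b # m) = n \<Longrightarrow> R (F (l @ a # b # m)) (F (l @ b # a # m))"
    and n: "length xs = n"
  shows "R (F xs) (F (sort xs))"
proof -
  have ins: "R (F (l @ a # m)) (F (l @ insort a m))" if "length (l @ a # m) = n" for l a m
    using that
  proof (induction m arbitrary: l)
    case Nil
    show ?case by (simp add: refl)
  next
    case (Cons b m)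
    have "R (F (l @ a # b # m)) (F ((l @ [b]) @ a # m))"
      using swap[of l a b m] Cons.prems by simp
    moreover have "R (F ((l @ [b]) @ a # m)) (F ((l @ [b]) @ insort a m))"
      using Cons.prems by (intro Cons.IH) simp
    ultimately show ?case using refl trans by auto
  qed
  have "R (F (l @ ys)) (F (l @ sort ys))" if "length (l @ ys) = n" for l ys
    using that
  proof (induction ys arbitrary: l)
    case Nil
    show ?case by (simp add: refl)
  next
    case (Cons a ys)
    have "R (F ((l @ [a]) @ ys)) (F ((l @ [a]) @ sort ys))"
      using Cons.prems by (intro Cons.IH) simp
    with ins[of l a "sort ys"] Cons.prems show ?case
      by (auto intro: trans)
  qed
  from this[of "[]" xs] n show ?thesis by simp
qed

lemma sorted_not_distinct_split:
  "sorted xs \<Longrightarrow> \<not> distinct xs \<Longrightarrow> \<exists>l a m. xs = l @ a # a # m"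
proof (induction xs)
  case (Cons x xs)
  show ?case
  proof (cases "distinct xs")
    case True
    with Cons.prems have "x \<in> set xs" by simp
    with Cons.prems obtain ys where "xs = x # ys"
      by (cases xs) (auto simp: order_antisym)
    then have "x # xs = [] @ x # x # ys" by simp
    then show ?thesis by blast
  next
    case False
    with Cons obtain l a m where "xs = l @ a # a # m" by auto
    then have "x # xs = (x # l) @ a # a # m" by simp
    then show ?thesis by blast
  qed
qed simp

lemma list_odd_cases:
  assumes "length l = 2 * k + 3"
  obtains (three) a b c where "k = 0" "l = [a, b, c]"
    | (more) k' a b m where "k = Suc k'" "l = a # b # m" "length m = 2 * k' + 3"
proof (cases k)
  case 0
  with assms three show thesis by (auto simp: length_Suc_conv numeral_eq_Suc)
next
  case (Suc k')
  with assms more show thesis by (auto simp: length_Suc_conv numeral_eq_Suc)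
qed

lemma comm_prod_step:
  "length m = 2 * k + 3 \<Longrightarrow> comm_prod (a # b # m) = br a b * comm_prod m"
  by (erule list_odd_cases) (auto simp: length_Suc_conv numeral_eq_Suc)

inductive_set add_span :: "'a::ab_group_add set \<Rightarrow> 'a set" for B where
  span_zero: "0 \<in> add_span B"
| span_base: "b \<in> B \<Longrightarrow> b \<in> add_span B"
| span_add: "x \<in> add_span B \<Longrightarrow> y \<in> add_span B \<Longrightarrow> x + y \<in> add_span B"
| span_neg: "x \<in> add_span B \<Longrightarrow> - x \<in> add_span B"

locale lie_nilpotent_hom = fa_hom \<rho> for \<rho> :: "fr \<Rightarrow> 'a::ring_1" +
  assumes nil4: "br (br (br a b) c) d = (0::'a)"
    and surj: "\<exists>f\<in>FA. a = \<rho> f"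
begin

lemma triple_central: "br (br a b) c * d = d * br (br a b) (c::'a)"
  using nil4[of a b c d] by (simp add: br_eq_0_iff)

text \<open>By the Jacobi identity the commutator of two pairs is a difference of two fourfold
  commutators.\<close>

lemma pairs_commute: "br a b * br c d = br c d * br a (b::'a)"
proof -
  have "br (br a b) (br c d) = br (br (br a b) c) d - br (br (br a b) d) c"
    by (simp add: br_def algebra_simps)
  then show ?thesis by (simp add: nil4 br_eq_0_iff)
qed

definition g5 :: "'a \<Rightarrow> 'a \<Rightarrow> 'a \<Rightarrow> 'a \<Rightarrow> 'a \<Rightarrow> 'a" where
  "g5 a b c d e = br (br a b) c * br d e"

lemma g5_swap12: "g5 a b c d e = - g5 b a c d e"
  by (simp add: g5_def br_skew[of a b] br_minus_left)

lemma g5_swap45: "g5 a b c d e = - g5 a b c e d"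
  by (simp add: g5_def br_skew[of d e])

text \<open>The Leibniz rule expands \<open>[a, b, cd, e] = 0\<close>; the fourfold commutators in
  it vanish and \<open>[a, b, c][d, e] + [c, e][a, b, d]\<close> remains.\<close>

lemma g5_swap34: "g5 a b c d e = - g5 a b d c e"
proof -
  have "0 = br (br (br a b) (c * d)) e" by (simp add: nil4)
  also have "\<dots> = g5 a b c d e + g5 a b d c e"
    by (simp add: br_mult_right br_add_left br_mult_left nil4 g5_def triple_central[of a b d "br c e"])
  finally show ?thesis by (simp add: eq_neg_iff_add_eq_0)
qed

text \<open>Expanding the relation \<^term>\<open>br (br (br (a * b) c) d) e = 0\<close> gives six terms, four of which
  cancel in pairs by the skew symmetry in the last three arguments.\<close>

lemma g5_swap14: "g5 a b c d e = - g5 d b c a e"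
proof -
  have *: "0 = g5 x u v y w + g5 y w v x u + g5 y w u x v + g5 x w u y v + g5 x w v y u + g5 y u v x w"
    for x y w u v
  proof -
    have "0 = br (br (br (x * y) w) u) v" by (simp add: nil4)
    also have "\<dots> = br (br x u) v * br y w + br x u * br (br y w) v + br x v * br (br y w) u
        + br (br x w) u * br y v + br (br x w) v * br y u + br x w * br (br y u) v"
      by (simp add: br_mult_left br_add_left nil4 algebra_simps)
    finally show ?thesis
      by (simp add: g5_def triple_central[of _ _ _ "br _ _", symmetric] algebra_simps)
  qed
  have s: "g5 p q x y z = - g5 p q z y x" for p q x y z
    by (metis g5_swap34 g5_swap45)
  have "0 = g5 a b c d e + g5 d e c a b + g5 d e b a c + g5 a e b d c + g5 a e c d b + g5 d b c a e"
    by (rule *)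
  also have "\<dots> = g5 a b c d e + g5 d b c a e"
    using s[of d e c a b] s[of a e b d c] by simp
  finally show ?thesis by (simp add: eq_neg_iff_add_eq_0)
qed

lemma g5_swap13: "g5 a b c d e = - g5 c b a d e"
  by (metis g5_swap14 g5_swap34)

lemma g5_swap23: "g5 a b c d e = - g5 a c b d e"
  by (metis g5_swap13 g5_swap12)

lemma g5_swap15: "g5 a b c d e = - g5 e b c d a"
  by (metis g5_swap14 g5_swap45)

text \<open>The three summands of the Jacobi identity differ by 3-cycles, which are even, so skew
  symmetry makes them equal.\<close>

lemma g5_torsion: "3 * g5 a b c d e = 0"
proof -
  have "br (br a b) c + br (br b c) a + br (br c a) b = 0"
    by (simp add: br_def algebra_simps)
  then have "(br (br a b) c + br (br b c) a + br (br c a) b) * br d e = 0" by simp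
  then have "g5 a b c d e + g5 b c a d e + g5 c a b d e = 0"
    by (simp add: g5_def distrib_right)
  moreover have "g5 b c a d e = g5 a b c d e" "g5 c a b d e = g5 a b c d e"
    by (metis g5_swap12 g5_swap13 minus_minus)+
  ultimately show ?thesis by (simp add: three_times)
qed

text \<open>Read the second factor as a pair with first entry \<open>[d, e]\<close>; exchanging that
  entry with \<open>a\<close> creates a fourfold commutator.\<close>

lemma triple_triple: "br (br a b) c * br (br d e) f = (0::'a)"
proof -
  have "br (br a b) c * br (br d e) f = - g5 (br d e) b c a f"
    using g5_swap14[of a b c "br d e" f] by (simp add: g5_def)
  then show ?thesis by (simp add: g5_def nil4)
qed

text \<open>The central triple commutator can join either pair, so \<open>b\<close> and
  \<open>c\<close> can each be exchanged with \<open>e\<close>. Three such exchanges compose to the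
  exchange of \<open>b\<close> and \<open>c\<close>.\<close>

lemma pairs_triple_skew:
  "br a b * br c d * br (br e f) g = - (br a c * br b d * br (br e f) (g::'a))"
proof -
  define s where "s a b c d e = br a b * br c d * br (br e f) g" for a b c d e
  have 1: "s a b c d e = br c d * g5 e f g a b" for a b c d e
    unfolding s_def g5_def
    by (simp only: pairs_commute[of a b c d] mult.assoc triple_central[of e f g "br a b"])
  have 2: "s a b c d e = br a b * g5 e f g c d" for a b c d e
    unfolding s_def g5_def
    by (simp only: mult.assoc triple_central[of e f g "br c d"])
  have be: "s a b c d e = - s a e c d b" for a b c d e
    unfolding 1 by (subst g5_swap15) simp
  have ce: "s a b c d e = - s a b e d c" for a b c d e
    unfolding 2 by (subst g5_swap14) simp
  have "s a b c d e = - s a c b d e" by (metis be ce)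
  then show ?thesis by (simp add: s_def)
qed

section \<open>Longer products of commutators\<close>

lemma triple_comm_prod: "length l = 2 * k + 3 \<Longrightarrow> br (br a b) c * comm_prod l = (0::'a)"
proof (induction k arbitrary: l)
  case 0
  then show ?case by (rule list_odd_cases) (simp_all add: triple_triple)
next
  case (Suc k)
  from Suc.prems show ?case
  proof (cases rule: list_odd_cases)
    case (more k' x y m)
    then show ?thesis
      using Suc.IH[of m] by (simp add: comm_prod_step flip: mult.assoc)
        (simp add: triple_central mult.assoc)
  qed simp
qed

text \<open>Moving \<open>x\<close> past a pair costs a triple commutator, which annihilates the
  remaining product.\<close>

lemma comm_prod_central: "length l = 2 * k + 3 \<Longrightarrow> comm_prod l * x = x * (comm_prod l :: 'a)"
proof (induction k arbitrary: l)
  case 0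
  then show ?case by (rule list_odd_cases) (simp_all add: triple_central)
next
  case (Suc k)
  from Suc.prems show ?case
  proof (cases rule: list_odd_cases)
    case (more k' a b m)
    have "br a b * (comm_prod m * x) = br a b * x * comm_prod m"
      using Suc.IH[of m] more by (simp add: mult.assoc)
    also have "\<dots> = (x * br a b + br (br a b) x) * comm_prod m"
      by (simp add: br_def[of "br a b" x])
    also have "\<dots> = x * (br a b * comm_prod m)"
      using more by (simp add: distrib_right triple_comm_prod mult.assoc)
    finally show ?thesis using more by (simp add: comm_prod_step mult.assoc)
  qed simp
qed

lemma pairs_comm_prod_skew:
  "length l = 2 * k + 3 \<Longrightarrow>
    br a b * (br c d * comm_prod l) = - (br a c * (br b d * (comm_prod l :: 'a)))"
proof (induction k arbitrary: l)
  case 0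
  then obtain x y z where "l = [x, y, z]" by (rule list_odd_cases) auto
  then show ?case using pairs_triple_skew[of a b c d x y z] by (simp add: mult.assoc)
next
  case (Suc k)
  from Suc.prems show ?case
  proof (cases rule: list_odd_cases)
    case (more k' p q m)
    have *: "br x y * (br z w * (br p q * r)) = br p q * (br x y * (br z w * r))" for x y z w r
      by (metis pairs_commute mult.assoc)
    show ?thesis using Suc.IH[of m] more by (simp add: comm_prod_step *)
  qed simp
qed

text \<open>The length guarantees a pair before the triple commutator. Leading pairs are stripped
  until the exchange lies within the first pair or straddles the first two, or until only five
  entries remain, where \<open>g5\<close> applies.\<close>

lemma comm_prod_swap:
  "length (l @ a # b # m) = 2 * k + 5 \<Longrightarrow>
    comm_prod (l @ a # b # m) = - (comm_prod (l @ b # a # m) :: 'a)"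
proof (induction k arbitrary: l)
  case 0
  have len: "length l + length m = 3" using 0 by simp
  have g: "comm_prod [a, b, c, d, e] = g5 c d e a b" for a b c d e :: 'a
    by (simp add: g5_def triple_central)
  consider x y z where "l = []" "m = [x, y, z]" | x y z where "l = [x]" "m = [y, z]"
    | x y z where "l = [x, y]" "m = [z]" | x y z where "l = [x, y, z]" "m = []"
  proof -
    have "length l = 0 \<and> length m = 3 \<or> length l = 1 \<and> length m = 2 \<or>
        length l = 2 \<and> length m = 1 \<or> length l = 3 \<and> length m = 0"
      using len by linarith
    then show ?thesis using that by (auto simp: length_Suc_conv numeral_eq_Suc)
  qed
  then show ?case
  proof cases
    case 1
    show ?thesis unfolding 1 append.simps g by (rule g5_swap45)
  next
    case 2
    show ?thesis unfolding 2 append.simps g by (rule g5_swap15)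
  next
    case 3
    show ?thesis unfolding 3 append.simps g by (rule g5_swap12)
  next
    case 4
    show ?thesis unfolding 4 append.simps g by (rule g5_swap23)
  qed
next
  case (Suc k)
  consider "l = []" | x where "l = [x]" | x y l' where "l = x # y # l'"
    by (cases l rule: remdups_adj.cases) auto
  then show ?case
  proof cases
    case 1
    then show ?thesis
      using Suc.prems by (simp add: comm_prod_step[where k = "Suc k"] br_skew[of a b])
  next
    case 2
    then obtain y m' where m: "m = y # m'" "length m' = 2 * k + 3"
      using Suc.prems by (cases m) auto
    with 2 show ?thesis
      using pairs_comm_prod_skew[OF m(2), of x a b y]
      by (simp add: comm_prod_step[of _ "Suc k"] comm_prod_step[of _ k])
  next
    case 3
    have len: "length (l' @ a # b # m) = 2 * k + 5" "length (l' @ b # a # m) = 2 * k + 5"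
      using Suc.prems 3 by simp_all
    have *: "comm_prod (x # y # n) = br x y * comm_prod n" if "length n = 2 * k + 5" for n
      by (rule comm_prod_step[of _ "Suc k"]) (use that in simp)
    show ?thesis using Suc.IH[OF len(1)] len 3 by (simp add: *)
  qed
qed

lemma comm_prod_torsion: "length l = 2 * k + 5 \<Longrightarrow> 3 * (comm_prod l :: 'a) = 0"
proof (induction k arbitrary: l)
  case 0
  then obtain a b c d e where "l = [a, b, c, d, e]"
    by (auto simp: length_Suc_conv numeral_eq_Suc)
  then show ?case using g5_torsion[of c d e a b] by (simp add: g5_def triple_central)
next
  case (Suc k)
  then obtain a b m where l: "l = a # b # m" and m: "length m = 2 * k + 5"
    by (auto simp: length_Suc_conv numeral_eq_Suc)
  have "comm_prod l = br a b * comm_prod m"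
    unfolding l by (rule comm_prod_step[of _ "Suc k"]) (use m in simp)
  moreover have "3 * (br a b * comm_prod m) = br a b * (3 * comm_prod m)"
    by (simp add: three_times algebra_simps)
  ultimately show ?case using Suc.IH[OF m] by simp
qed

section \<open>The additive span of the images of \<open>Eset\<close>\<close>

abbreviation X :: "nat \<Rightarrow> 'a" where "X i \<equiv> \<rho> (fvar i)"

abbreviation word :: "nat list \<Rightarrow> 'a" where "word w \<equiv> prod_list (map X w)"

abbreviation S :: "'a set" where "S \<equiv> add_span (\<rho> ` Eset)"

text \<open>By surjectivity every element is an integer combination of words in the letters.\<close>

lemma generated_by_letters [case_names var zero one add neg mult]:
  assumes var: "\<And>i. P (X i)" and zero: "P 0" and one: "P 1"
    and add: "\<And>a b. P a \<Longrightarrow> P b \<Longrightarrow> P (a + b)" and neg: "\<And>a. P a \<Longrightarrow> P (- a)"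
    and mult: "\<And>a b. P a \<Longrightarrow> P b \<Longrightarrow> P (a * b)"
  shows "P (a::'a)"
proof -
  have int: "P (of_int c)" for c
  proof (induction c rule: int_induct[where k = 0])
    case (step2 i)
    then show ?case using add[of "of_int i" "- 1"] neg one by simp
  qed (use zero one add in auto)
  have mon: "P (\<rho> (fmon c u))" for c u
  proof (induction u)
    case Nil
    have "fmon c [] = fsmul c fone" by (auto simp: fmon_def fsmul_def fone_def)
    then show ?case using int hom_smul[of fone c] by (simp add: hom_one)
  next
    case (Cons i u)
    have "fmon c (i # u) = fmul (fvar i) (fmon c u)" by (simp add: fvar_eq_fmon fmul_fmon)
    then show ?case using Cons var mult by (simp add: hom_mul)
  qed
  have "P (\<rho> f)" if "f \<in> FA" for f
    using that by (induction rule: FA_induct) (simp_all add: hom_zero zero hom_add add mon)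
  then show ?thesis using surj[of a] by auto
qed

lemma word_comm_prod_sorted_in_S:
  assumes len: "length is = 2 * k + 5" and js: "sorted js"
  shows "word js * comm_prod (map X is) \<in> S"
proof -
  let ?F = "\<lambda>l. comm_prod (map X l)"
  have sort: "?F is = ?F (sort is) \<or> ?F is = - ?F (sort is)"
  proof (rule sort_related[where n = "2 * k + 5" and R = "\<lambda>x y. x = y \<or> x = - y"])
    show "?F (l @ a # b # m) = ?F (l @ b # a # m) \<or> ?F (l @ a # b # m) = - ?F (l @ b # a # m)"
      if "length (l @ a # b # m) = 2 * k + 5" for l a b m
      using comm_prod_swap[of "map X l" "X a" "X b" "map X m" k] that by simp
  qed (use len in auto)
  have "word js * ?F (sort is) \<in> S"
  proof (cases "distinct (sort is)")
    case True
    then have "sorted_wrt (<) (sort is)" by (simp add: strict_sorted_iff)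
    moreover have len': "length (sort is) = 2 * (k + 1) + 3" using len by simp
    ultimately have "Eelt js (k + 1) (sort is) \<in> Eset" using js unfolding Eset_def
      by (intro CollectI exI[of _ js] exI[of _ "k + 1"] exI[of _ "sort is"]) simp
    then show ?thesis using hom_Eelt[OF len', of js] by (metis image_eqI span_base)
  next
    case False
    then obtain l a m where l: "sort is = l @ a # a # m"
      using sorted_not_distinct_split[of "sort is"] by auto
    have len': "length (l @ a # a # m) = 2 * k + 5"
      using len l by (metis length_sort)
    \<comment> \<open>Exchanging the two equal entries makes the product its own negative; being
      killed by both 2 and 3, it is zero.\<close>
    have "?F (sort is) = - ?F (sort is)"
      using comm_prod_swap[of "map X l" "X a" "X a" "map X m" k] len' by (simp add: l)
    moreover have "3 * ?F (sort is) = 0"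
      using comm_prod_torsion[of "map X (sort is)" k] len by simp
    ultimately have "?F (sort is) = 0"
      by (simp add: three_times eq_neg_iff_add_eq_0)
    then show ?thesis by (simp add: span_zero)
  qed
  with sort show ?thesis by (auto dest: span_neg)
qed

text \<open>Exchanging adjacent prefix letters leaves a commutator that joins the commutator
  product: the prefix loses two letters and \<open>is\<close> gains two, so induction on the prefix
  length applies.\<close>

lemma word_comm_prod_in_S:
  "length is = 2 * k + 5 \<Longrightarrow> word js * comm_prod (map X is) \<in> S"
proof (induction "length js" arbitrary: js k "is" rule: less_induct)
  case less
  let ?H = "comm_prod (map X is)"
  have H: "length (map X is) = 2 * (k + 1) + 3" using less.prems by simp
  have "word js * ?H - word (sort js) * ?H \<in> S"
  proof (rule sort_related[where n = "length js" and R = "\<lambda>x y. x - y \<in> S" and F = "\<lambda>w. word w * ?H"])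
    show "x - z \<in> S" if "x - y \<in> S" "y - z \<in> S" for x y z
      using span_add[OF that] by simp
    show "word (l @ a # b # m) * ?H - word (l @ b # a # m) * ?H \<in> S"
      if len: "length (l @ a # b # m) = length js" for l a b m
    proof -
      \<comment> \<open>The commutator of the new pair with the rest of the prefix is a triple
        commutator and annihilates \<open>?H\<close>, so the pair can be moved next to
        \<open>?H\<close>.\<close>
      have t: "br (br (X a) (X b)) (word m) * ?H = 0" by (rule triple_comm_prod[OF H])
      have "br (X a) (X b) * word m * ?H = (word m * br (X a) (X b) + br (br (X a) (X b)) (word m)) * ?H"
        by (simp add: br_def[of "br (X a) (X b)"])
      also have "\<dots> = word m * (br (X a) (X b) * ?H)"
        by (simp only: distrib_right t) (simp add: mult.assoc)
      also have "br (X a) (X b) * ?H = comm_prod (map X (a # b # is))"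
        using comm_prod_step[OF H, of "X a" "X b"] by simp
      finally have "word l * (br (X a) (X b) * word m * ?H)
          = word (l @ m) * comm_prod (map X (a # b # is))"
        by (simp add: mult.assoc)
      moreover have "word (l @ a # b # m) * ?H - word (l @ b # a # m) * ?H
          = word l * (br (X a) (X b) * word m * ?H)"
        by (simp add: br_def algebra_simps)
      moreover have "word (l @ m) * comm_prod (map X (a # b # is)) \<in> S"
        by (rule less.hyps[of _ _ "Suc k"]) (use len less.prems in auto)
      ultimately show ?thesis by simp
    qed
  qed (auto simp: span_zero)
  moreover have "word (sort js) * ?H \<in> S"
    by (rule word_comm_prod_sorted_in_S[OF less.prems]) simp
  ultimately show ?case using span_add by fastforce
qed

text \<open>Dropping the ordering conditions of \<open>Eset\<close> makes the generators stable
  under multiplication by a letter, which is what the ideal property requires.\<close>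

lemma S_induct [consumes 1, case_names base zero add neg]:
  assumes "x \<in> S"
    and "\<And>js k is. length is = 2 * k + 5 \<Longrightarrow> P (word js * comm_prod (map X is))"
    and "P 0" and "\<And>x y. P x \<Longrightarrow> P y \<Longrightarrow> P (x + y)" and "\<And>x. P x \<Longrightarrow> P (- x)"
  shows "P x"
  using assms(1)
proof (induction rule: add_span.induct)
  case (span_base b)
  then obtain js k "is" where b: "b = \<rho> (Eelt js k is)" and k: "k \<ge> 1" and len: "length is = 2 * k + 3"
    by (auto simp: Eset_def)
  obtain k' where "k = Suc k'" using k by (cases k) auto
  with len have "length is = 2 * k' + 5" by simp
  then show ?case using assms(2) by (simp add: b hom_Eelt[OF len])
qed (use assms in auto)

lemma S_left: "x \<in> S \<Longrightarrow> a * x \<in> S"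
proof (induction a arbitrary: x rule: generated_by_letters)
  case (var i)
  then show ?case
  proof (induction rule: S_induct)
    case (base js k "is")
    then show ?case
      using word_comm_prod_in_S[of "is" k "i # js"] by (simp add: mult.assoc)
  qed (auto simp: distrib_left intro: span_zero span_add span_neg)
qed (auto simp: distrib_right mult.assoc intro: span_zero span_add span_neg)

lemma S_right: "x \<in> S \<Longrightarrow> x * a \<in> S"
proof (induction a arbitrary: x rule: generated_by_letters)
  case (var i)
  then show ?case
  proof (induction rule: S_induct)
    case (base js k "is")
    then have "length (map X is) = 2 * (k + 1) + 3" by simp
    from comm_prod_central[OF this, of "X i"] show ?case
      using word_comm_prod_in_S[of "is" k "js @ [i]"] base by (simp add: mult.assoc)
  qed (auto simp: distrib_right intro: span_zero span_add span_neg)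
qed (auto simp: distrib_left mult.assoc[symmetric] intro: span_zero span_add span_neg)

text \<open>Skew symmetry lets each of the five arguments be moved into the slot in which
  being in \<^term>\<open>S\<close> passes from letters to arbitrary elements.\<close>

lemma g5_in_S: "g5 a b c d e \<in> S"
proof -
  have ext: "g5 a b c d e \<in> S" if "\<And>i. g5 a b c (X i) e \<in> S" for a b c d e
  proof (induction d rule: generated_by_letters)
    case (mult x y)
    have "g5 a b c (x * y) e = x * g5 a b c y e + g5 a b c x e * y"
      by (simp add: g5_def br_mult_left distrib_left triple_central[of a b c x] flip: mult.assoc)
    with mult show ?case by (simp add: S_left S_right span_add)
  next
    case one
    then show ?case by (simp add: g5_def br_def span_zero)
  next
    case zero
    then show ?case by (simp add: g5_def br_def span_zero)
  next
    case (add x y)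
    then show ?case using span_add by (fastforce simp: g5_def br_add_left distrib_left)
  next
    case (neg x)
    then show ?case using span_neg by (fastforce simp: g5_def br_minus_left)
  qed (rule that)
  have s12: "g5 a b c d e \<in> S" if "g5 b a c d e \<in> S" for a b c d e
    using span_neg[OF that] by (subst g5_swap12)
  have s14: "g5 a b c d e \<in> S" if "g5 d b c a e \<in> S" for a b c d e
    using span_neg[OF that] by (subst g5_swap14)
  have s34: "g5 a b c d e \<in> S" if "g5 a b d c e \<in> S" for a b c d e
    using span_neg[OF that] by (subst g5_swap34)
  have s45: "g5 a b c d e \<in> S" if "g5 a b c e d \<in> S" for a b c d e
    using span_neg[OF that] by (subst g5_swap45)
  have "g5 (X i) (X j) (X k) (X l) (X m) \<in> S" for i j k l m
    using word_comm_prod_in_S[of "[l, m, i, j, k]" 0 "[]"] by (simp add: g5_def triple_central)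
  then have 1: "g5 (X i) (X j) (X k) d (X m) \<in> S" for i j k d m
    by (rule ext)
  have 2: "g5 (X i) (X j) (X k) d e \<in> S" for i j k d e
    by (rule s45, rule ext, rule s45, rule 1)
  have 3: "g5 (X i) (X j) c d e \<in> S" for i j c d e
    by (rule s34, rule ext, rule s34, rule 2)
  have 4: "g5 a (X j) c d e \<in> S" for a j c d e
    by (rule s14, rule ext, rule s14, rule 3)
  \<comment> \<open>The second argument reaches the fourth slot by way of the first.\<close>
  show ?thesis
    by (rule s12, rule s14, rule ext, rule s14, rule s12, rule 4)
qed

lemma hom_T32_in_S: "f \<in> T32 \<Longrightarrow> \<rho> f \<in> S"
proof -
  assume "f \<in> T32"
  then have "f \<in> FA \<and> \<rho> f \<in> S"
    unfolding T32_def
  proof (induction rule: ideal_gen.induct)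
    case (gen s)
    then consider a b c d where "s = comm4 a b c d" "{a, b, c, d} \<subseteq> FA"
      | a b c d e where "s = fmul (comm a b) (comm3 c d e)" "{a, b, c, d, e} \<subseteq> FA"
      by blast
    then show ?case
    proof cases
      case 1
      then show ?thesis by (simp add: hom_comm4 nil4 span_zero)
    next
      case 2
      then have "\<rho> s = g5 (\<rho> c) (\<rho> d) (\<rho> e) (\<rho> a) (\<rho> b)"
        by (simp add: hom_mul hom_comm hom_comm3 g5_def triple_central)
      then show ?thesis using 2 g5_in_S by simp
    qed
  qed (simp_all add: hom_zero hom_add hom_neg hom_mul span_zero span_add span_neg S_left S_right)
  then show ?thesis ..
qed

lemma S_torsion: "x \<in> S \<Longrightarrow> 3 * x = 0"
proof (induction rule: S_induct)
  case (base js k "is")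
  have "3 * (word js * comm_prod (map X is)) = word js * (3 * comm_prod (map X is))"
    by (simp add: three_times algebra_simps)
  then show ?case using comm_prod_torsion[of "map X is" k] base by simp
qed (simp_all add: distrib_left)

lemma S_lincomb: "x \<in> S \<Longrightarrow> \<exists>F c. finite F \<and> F \<subseteq> Eset \<and> x = \<rho> (lincomb F c)"
proof (induction rule: add_span.induct)
  case span_zero
  then show ?case by (intro exI[of _ "{}"]) (simp add: lincomb_def hom_zero flip: fzero_def)
next
  case (span_base b)
  then obtain e where "e \<in> Eset" "b = \<rho> e" by auto
  then show ?case
    by (intro exI[of _ "{e}"] exI[of _ "\<lambda>_. 1"]) (simp add: lincomb_def)
next
  case (span_add x y)
  then obtain F c G d where F: "finite F" "F \<subseteq> Eset" "x = \<rho> (lincomb F c)"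
    and G: "finite G" "G \<subseteq> Eset" "y = \<rho> (lincomb G d)" by blast
  let ?c = "\<lambda>e. (if e \<in> F then c e else 0) + (if e \<in> G then d e else 0)"
  have FA: "F \<subseteq> FA" "G \<subseteq> FA" using F G Eset_subset_FA by auto
  have "lincomb (F \<union> G) ?c = fadd (lincomb F c) (lincomb G d)"
  proof
    fix w
    have "(\<Sum>e\<in>F \<union> G. (if e \<in> F then c e else 0) * e w) = (\<Sum>e\<in>F. c e * e w)"
      "(\<Sum>e\<in>F \<union> G. (if e \<in> G then d e else 0) * e w) = (\<Sum>e\<in>G. d e * e w)"
      using F G by (auto intro!: sum.mono_neutral_cong_right)
    then show "lincomb (F \<union> G) ?c w = fadd (lincomb F c) (lincomb G d) w"
      by (simp add: lincomb_def fadd_def distrib_right sum.distrib)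
  qed
  then have "\<rho> (lincomb (F \<union> G) ?c) = x + y"
    using F G FA by (simp add: hom_add hom_lincomb)
  then show ?case using F G by (intro exI[of _ "F \<union> G"] exI[of _ ?c]) auto
next
  case (span_neg x)
  then obtain F c where F: "finite F" "F \<subseteq> Eset" "x = \<rho> (lincomb F c)" by blast
  have "lincomb F (\<lambda>e. - c e) = fneg (lincomb F c)"
    by (simp add: lincomb_def fneg_def sum_negf)
  moreover have "F \<subseteq> FA" using F Eset_subset_FA by blast
  with F have "lincomb F c \<in> FA" by (simp add: hom_lincomb)
  ultimately have "- x = \<rho> (lincomb F (\<lambda>e. - c e))"
    by (simp only: F(3) hom_neg)
  then show ?case using F(1,2) by (intro exI[of _ F] exI[of _ "\<lambda>e. - c e"]) simp
qed

end

section \<open>A model of Lie nilpotency class 3\<close>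

definition fa_eval :: "(nat \<Rightarrow> 'a::ring_1) \<Rightarrow> fr \<Rightarrow> 'a" where
  "fa_eval V f = (\<Sum>w | f w \<noteq> 0. of_int (f w) * prod_list (map V w))"

lemma fa_eval_superset:
  "finite A \<Longrightarrow> {w. f w \<noteq> 0} \<subseteq> A \<Longrightarrow>
    fa_eval V f = (\<Sum>w\<in>A. of_int (f w) * prod_list (map V w))"
  unfolding fa_eval_def by (rule sum.mono_neutral_left) auto

lemma fa_eval_fadd:
  assumes "f \<in> FA" "g \<in> FA"
  shows "fa_eval V (fadd f g) = fa_eval V f + fa_eval V g"
proof -
  let ?A = "{w. f w \<noteq> 0} \<union> {w. g w \<noteq> 0}"
  have A: "finite ?A" using assms by (simp add: FA_def)
  have "fa_eval V h = (\<Sum>w\<in>?A. of_int (h w) * prod_list (map V w))" if "h \<in> {f, g, fadd f g}" for h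
    by (rule fa_eval_superset[OF A]) (use that in \<open>auto simp: fadd_def\<close>)
  then show ?thesis by (simp add: fadd_def distrib_right sum.distrib)
qed

lemma fa_eval_fmon: "fa_eval V (fmon c u) = of_int c * prod_list (map V u)"
  by (subst fa_eval_superset[of "{u}"]) (auto simp: fmon_def)

lemma fa_hom_fa_eval: "fa_hom (fa_eval V)"
proof
  fix f g assume f: "f \<in> FA" and g: "g \<in> FA"
  show "fa_eval V (fadd f g) = fa_eval V f + fa_eval V g"
    by (rule fa_eval_fadd[OF f g])
  have [simp]: "fa_eval V fzero = 0" by (simp add: fa_eval_def fzero_def)
  have comm: "x * (of_int d * y) = of_int d * (x * (y::'a))" for x y d
    by (metis mult.assoc mult_of_int_commute)
  have mon: "fa_eval V (fmul (fmon c u) g) = fa_eval V (fmon c u) * fa_eval V g" for c u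
    using g by (induction rule: FA_induct)
      (simp_all add: fmul_fadd_right fa_eval_fadd fmul_fmon fa_eval_fmon distrib_left mult.assoc
        comm[of "prod_list (map V u)"])
  show "fa_eval V (fmul f g) = fa_eval V f * fa_eval V g"
    using f by (induction rule: FA_induct)
      (simp_all add: fmul_fadd_left fa_eval_fadd distrib_right g mon)
next
  show "fa_eval V fone = 1" by (simp add: fone_eq_fmon fa_eval_fmon)
qed

lemma fa_eval_fvar: "fa_eval V (fvar i) = V i"
  by (simp add: fvar_eq_fmon fa_eval_fmon)

section \<open>Commutators computed from the relations of the model\<close>

lemma assoc_extend: "x * y = p * q \<Longrightarrow> x * (y * r) = p * (q * (r::'a::ring_1))"
  by (metis mult.assoc)

lemma assoc_extend_neg: "x * y = - (p * q) \<Longrightarrow> x * (y * r) = - (p * (q * (r::'a::ring_1)))"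
  by (metis mult.assoc mult_minus_left)

locale cubic_model =
  fixes X e :: "nat \<Rightarrow> 'a::ring_1" and z \<Phi> :: 'a
  assumes char3: "(3::'a) = 0"
    and e_z: "z * e i = - (e i * z)" and z_z: "z * z = 0"
    and e_X: "e i * X j = X j * e i" and z_X: "z * X j = X j * z"
    and \<Phi>_e: "\<Phi> * e i = e i * \<Phi>" and z_\<Phi>: "z * \<Phi> = z" and \<Phi>_z: "\<Phi> * z = z"
    and e_e: "e i * e j = - (e j * e i)"
    and X_X: "X b * X a = X a * X b + e b * e a * \<Phi>"
    and \<Phi>_X: "\<Phi> * X k = X k * \<Phi> + e k * z"
begin

primrec W where
  "W [] = 1"
| "W (a # w) = X a * W w"

text \<open>\<open>D\<close>, \<open>Q\<close> and \<open>T\<close> are the divided powers, of orders 1, 2 and 3, of the odd derivation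
  sending \<^term>\<open>X a\<close> to \<^term>\<open>e a\<close>: they replace one, two or three letters of a word.\<close>

primrec D where
  "D [] = 0"
| "D (a # w) = e a * W w + X a * D w"

primrec Q where
  "Q [] = 0"
| "Q (a # w) = e a * D w + X a * Q w"

primrec T where
  "T [] = 0"
| "T (a # w) = e a * Q w + X a * T w"

lemmas e_X' = assoc_extend[OF e_X] and z_X' = assoc_extend[OF z_X]
  and e_z' = assoc_extend_neg[OF e_z] and \<Phi>_e' = assoc_extend[OF \<Phi>_e]

lemma z_z': "z * (z * r) = 0" and z_\<Phi>': "z * (\<Phi> * r) = z * r" and \<Phi>_z': "\<Phi> * (z * r) = z * r"
  by (simp_all add: z_z z_\<Phi> \<Phi>_z flip: mult.assoc)

lemma X_X': "X b * (X a * r) = X a * (X b * r) + e b * (e a * (\<Phi> * r))"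
  by (simp add: X_X[of b a] distrib_right flip: mult.assoc)

lemma \<Phi>_X': "\<Phi> * (X k * r) = X k * (\<Phi> * r) + e k * (z * r)"
  by (simp add: \<Phi>_X distrib_right flip: mult.assoc)

lemma e_W: "e i * W w = W w * e i"
  by (induction w) (simp_all add: e_X' mult.assoc)

lemma z_W: "z * W w = W w * z"
  by (induction w) (simp_all add: z_X' mult.assoc)

lemmas e_W' = assoc_extend[OF e_W] and z_W' = assoc_extend[OF z_W]

lemma e_D: "e i * D w = - (D w * e i)"
proof (induction w)
  case (Cons a w)
  have "e i * (e a * W w) = - (e a * (W w * e i))"
    using e_e[of i a] by (simp add: e_W e_W')
  then show ?case by (simp add: Cons e_X' distrib_left distrib_right mult.assoc)
qed simp

lemma z_D: "z * D w = - (D w * z)"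
  by (induction w) (simp_all add: distrib_left distrib_right mult.assoc z_X' z_W e_z')

lemmas e_D' = assoc_extend_neg[OF e_D] and z_D' = assoc_extend_neg[OF z_D]

lemma e_Q: "e i * Q w = Q w * e i"
proof (induction w)
  case (Cons a w)
  have "e i * (e a * D w) = e a * (D w * e i)"
    using assoc_extend_neg[OF e_e[of i a], of "D w"] by (simp add: e_D)
  then show ?case by (simp add: Cons e_X' distrib_left distrib_right mult.assoc)
qed simp

lemma z_Q: "z * Q w = Q w * z"
  by (induction w) (simp_all add: distrib_left distrib_right mult.assoc z_X' z_D e_z')

lemmas e_Q' = assoc_extend[OF e_Q] and z_Q' = assoc_extend[OF z_Q]

lemma e_T: "e i * T w = - (T w * e i)"
proof (induction w)
  case (Cons a w)
  have "e i * (e a * Q w) = - (e a * (Q w * e i))"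
    using assoc_extend_neg[OF e_e[of i a], of "Q w"] by (simp add: e_Q)
  then show ?case by (simp add: Cons e_X' distrib_left distrib_right mult.assoc)
qed simp

lemma z_T: "z * T w = - (T w * z)"
  by (induction w) (simp_all add: distrib_left distrib_right mult.assoc z_X' z_Q e_z')

lemmas e_T' = assoc_extend_neg[OF e_T] and z_T' = assoc_extend_neg[OF z_T]

text \<open>Oriented rules that carry \<open>e\<close> and \<open>z\<close> to the right past words
  and their divided powers, and \<open>z\<close> and \<open>\<Phi>\<close> past \<open>e\<close>.
  Anticommutation of two \<open>e\<close> has no such direction and is instantiated by hand.\<close>

lemmas push = e_X e_X' z_X z_X' e_z e_z' \<Phi>_e \<Phi>_e' z_z z_z' z_\<Phi> z_\<Phi>' \<Phi>_z \<Phi>_z'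
  e_W e_W' z_W z_W' e_D e_D' z_D z_D' e_Q e_Q' z_Q z_Q' e_T e_T' z_T z_T'
  distrib_left distrib_right mult.assoc right_diff_distrib left_diff_distrib

lemma \<Phi>_W: "\<Phi> * W w = W w * \<Phi> + D w * z"
proof (induction w)
  case (Cons a w)
  then show ?case by (simp add: \<Phi>_X' push)
qed simp

lemma \<Phi>_W': "\<Phi> * (W w * r) = W w * (\<Phi> * r) + D w * (z * r)"
  by (simp add: \<Phi>_W distrib_right flip: mult.assoc)

text \<open>The corrections from \<open>\<Phi>_W\<close> and \<open>\<Phi>_X\<close> cancel because
  \<open>z\<close> and \<open>D w\<close> anticommute.\<close>

lemma \<Phi>_D: "\<Phi> * D w = D w * \<Phi>"
proof (induction w)
  case (Cons a w)
  then show ?case by (simp add: \<Phi>_X' \<Phi>_W \<Phi>_W' push)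
qed simp

lemma \<Phi>_Q_z: "\<Phi> * (Q w * (z * r)) = Q w * (z * r)"
  by (metis \<Phi>_z' z_Q')

lemma \<Phi>_T_z: "\<Phi> * (T w * (z * r)) = T w * (z * r)"
  by (metis \<Phi>_z' z_T' minus_minus mult_minus_right)

text \<open>Each letter \<open>b\<close> of \<open>w\<close> contributes
  \<open>e b * e a * \<Phi>\<close>. Moving \<open>\<Phi>\<close> to the right end replaces a second
  letter, and \<open>e a\<close> passing the resulting odd factor gives the minus sign.\<close>

lemma W_X: "W w * X a = X a * W w + D w * (e a * \<Phi>) - Q w * (e a * z)"
proof (induction w)
  case (Cons b w)
  then show ?case by (simp add: X_X'[of b a] \<Phi>_W push)
qed simp

lemma W_X': "W w * (X a * r) = X a * (W w * r) + D w * (e a * (\<Phi> * r)) - Q w * (e a * (z * r))"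
  by (simp add: W_X distrib_right left_diff_distrib flip: mult.assoc)

text \<open>The terms with \<open>\<Phi>\<close> cancel because \<open>e a\<close> and
  \<open>D w\<close> anticommute; only a third-order part survives.\<close>

lemma D_X: "D w * X a = X a * D w - T w * (e a * z)"
proof (induction w)
  case (Cons b w)
  then show ?case by (simp add: W_X' X_X'[of b a] \<Phi>_D assoc_extend_neg[OF e_e[of a b]] push)
qed simp

lemma D_X': "D w * (X a * r) = X a * (D w * r) - T w * (e a * (z * r))"
  by (simp add: D_X left_diff_distrib flip: mult.assoc)

text \<open>In front of \<open>z\<close> the factor \<open>\<Phi>\<close> acts as 1 and further
  multiples of \<open>z\<close> vanish, so the expansion stops at \<open>T\<close>.\<close>

lemma Q_X_z: "Q w * (X a * z) = X a * (Q w * z) + T w * (e a * z)"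
proof (induction w)
  case (Cons b w)
  have "\<Phi> * (Q w * z) = Q w * z" using \<Phi>_Q_z[of w 1] by simp
  with Cons show ?case by (simp add: D_X' X_X'[of b a] push)
qed simp

lemma Q_X_z': "Q w * (X a * (z * r)) = X a * (Q w * (z * r)) + T w * (e a * (z * r))"
  using arg_cong[OF Q_X_z, of "\<lambda>s. s * r" w a] by (simp add: distrib_right mult.assoc)

lemma T_X_z: "T w * (X a * z) = X a * (T w * z)"
proof (induction w)
  case (Cons b w)
  have "\<Phi> * (T w * z) = T w * z" using \<Phi>_T_z[of w 1] by simp
  moreover have "Q w * (X a * (e b * z)) = X a * (Q w * (e b * z)) + T w * (e a * (e b * z))"
    using arg_cong[OF Q_X_z'[of w a "e b"], of uminus] by (simp add: e_z)
  ultimately show ?case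
    using Cons by (simp add: X_X'[of b a] assoc_extend_neg[OF e_e[of a b]] push)
qed simp

lemma T_X_z': "T w * (X a * (z * r)) = X a * (T w * (z * r))"
  using arg_cong[OF T_X_z, of "\<lambda>s. s * r" w a] by (simp add: mult.assoc)

lemma T_X_D_z: "T u * (X a * (D v * z)) = X a * (T u * (D v * z))"
  using T_X_z'[of u a "D v"] by (simp add: z_D)

lemma Q_W_z: "Q u * (W v * z) = W v * (Q u * z) + T u * (D v * z)"
proof (induction v)
  case (Cons a v)
  have "Q u * (X a * (W v * z)) = Q u * (X a * (z * W v))" by (simp only: z_W)
  also have "\<dots> = X a * (Q u * (W v * z)) + T u * (e a * (W v * z))" by (subst Q_X_z') (simp only: z_W)
  finally show ?case by (simp add: Cons T_X_D_z distrib_left distrib_right mult.assoc)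
qed simp

lemma D_W: "D u * W v = W v * D u - T u * (D v * z)"
proof (induction v)
  case (Cons a v)
  have "D u * (X a * W v) = X a * (D u * W v) - T u * (e a * (W v * z))"
    by (simp add: D_X' z_W)
  then show ?case
    by (simp add: Cons T_X_D_z distrib_left distrib_right right_diff_distrib mult.assoc)
qed simp

lemma D_X_D_z: "D u * (X a * (D v * z)) = X a * (D u * (D v * z))"
  by (simp add: D_X' push)

lemma D_D_z: "D u * (D v * z) = - (D v * (D u * z))"
proof (induction v)
  case (Cons a v)
  have "D u * (e a * (W v * z)) = - (e a * (D u * W v * z))"
    by (simp add: e_D' mult.assoc)
  also have "D u * W v * z = W v * (D u * z)"
    by (simp add: D_W push)
  finally show ?case
    by (simp add: Cons D_X_D_z distrib_left distrib_right mult.assoc)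
qed simp

text \<open>Both terms of \<open>W_X\<close> yield the same \<open>T\<close> correction when
  commuted with \<open>W v\<close>. These cancel, and what remains comes from
  \<open>[\<Phi>, W v] = D v * z\<close>.\<close>

lemma br_W_X_W: "br (br (W u) (X a)) (W v) = D u * (e a * (D v * z))"
proof -
  let ?c = "br (W u) (X a)"
  have c: "?c = D u * (e a * \<Phi>) - Q u * (e a * z)"
    by (simp add: br_def W_X)
  have 1: "D u * (e a * (\<Phi> * W v))
      = W v * (D u * (e a * \<Phi>)) + T u * (D v * (e a * z)) + D u * (e a * (D v * z))"
  proof -
    have "D u * (e a * (\<Phi> * W v)) = D u * W v * (e a * \<Phi>) + D u * (e a * (D v * z))"
      by (simp add: \<Phi>_W distrib_left e_W' mult.assoc)
    also have "D u * W v * (e a * \<Phi>) = W v * (D u * (e a * \<Phi>)) + T u * (D v * (e a * z))"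
      by (simp add: D_W left_diff_distrib mult.assoc e_z' z_\<Phi>)
    finally show ?thesis by simp
  qed
  have 2: "Q u * (e a * (z * W v)) = W v * (Q u * (e a * z)) + T u * (D v * (e a * z))"
  proof -
    have "Q u * (e a * (z * W v)) = - (Q u * (W v * z) * e a)"
      by (simp add: z_W e_W' mult.assoc e_z)
    also have "\<dots> = W v * (Q u * (e a * z)) + T u * (D v * (e a * z))"
      by (simp add: Q_W_z distrib_right mult.assoc e_z)
    finally show ?thesis .
  qed
  show ?thesis
    unfolding c br_def[of _ "W v"]
    by (simp add: left_diff_distrib right_diff_distrib mult.assoc 1 2)
qed

text \<open>The Jacobi identity gives a difference of two values of \<open>br_W_X_W\<close>, which
  is -2 times the right-hand side; in characteristic 3 the factor is 1.\<close>

lemma br_W_W_X: "br (br (W u) (W v)) (X a) = D u * (D v * (e a * z))"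
proof -
  have s: "x * (y * (e a * z)) = - (x * (y * z) * e a)" for x y
    by (simp add: mult.assoc e_z)
  have "br (br (W u) (W v)) (X a) = br (br (W u) (X a)) (W v) - br (br (W v) (X a)) (W u)"
    by (simp add: br_def algebra_simps)
  also have "\<dots> = D u * (e a * (D v * z)) - D v * (e a * (D u * z))"
    by (simp only: br_W_X_W)
  also have "\<dots> = - (D u * (D v * (e a * z))) + D v * (D u * (e a * z))"
    by (simp add: e_D')
  also have "D v * (D u * (e a * z)) = - (D u * (D v * (e a * z)))"
    unfolding s D_D_z[of v u] by simp
  also have "- y + - y = y" for y :: 'a
  proof -
    have "y + y + y = 0" using three_times[of y] by (simp only: char3 mult_zero_left)
    then have "y = - (y + y)" by (metis add.assoc eq_neg_iff_add_eq_0)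
    then show ?thesis by simp
  qed
  finally show ?thesis .
qed

lemma br_W_W_W: "br (br (W u) (W v)) (W w) = D u * (D v * (D w * z))"
proof (induction w)
  case Nil
  show ?case by (simp add: br_def)
next
  case (Cons a w)
  let ?r = "br (W u) (W v)"
  have "br ?r (W (a # w)) = br ?r (X a) * W w + X a * br ?r (W w)"
    by (simp add: br_def algebra_simps)
  also have "\<dots> = D u * (D v * (e a * (W w * z))) + X a * (D u * (D v * (D w * z)))"
    by (simp add: br_W_W_X Cons mult.assoc z_W)
  also have "X a * (D u * (D v * (D w * z))) = D u * (D v * (X a * (D w * z)))"
    by (simp add: D_X' D_X_D_z push)
  finally show ?case by (simp add: distrib_left distrib_right mult.assoc)
qed

text \<open>The triple commutator \<open>D u * (D v * (D w * z))\<close> commutes with each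
  \<open>X a\<close>: every correction from \<open>D_X\<close> carries a second \<open>z\<close>,
  and \<open>z * z = 0\<close>.\<close>

lemma br4_W: "br (br (br (W u) (W v)) (W w)) (W y) = 0"
proof (induction y)
  case Nil
  show ?case by (simp add: br_def)
next
  case (Cons a y)
  let ?r = "br (br (W u) (W v)) (W w)"
  have "br ?r (X a) = 0"
    unfolding br_W_W_W unfolding br_def by (simp add: D_X' D_X push)
  moreover have "br ?r (W (a # y)) = br ?r (X a) * W y + X a * br ?r (W y)"
    by (simp add: br_def algebra_simps)
  ultimately show ?case using Cons by simp
qed

lemma W_eq: "W w = prod_list (map X w)"
  by (induction w) simp_all

lemma br4_fa_eval:
  assumes "f1 \<in> FA" "f2 \<in> FA" "f3 \<in> FA" "f4 \<in> FA"
  shows "br (br (br (fa_eval X f1) (fa_eval X f2)) (fa_eval X f3)) (fa_eval X f4) = 0"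
proof -
  \<comment> \<open>The fourfold commutator is additive in each argument, so the arguments can be
    reduced to words one at a time.\<close>
  have ext: "L (fa_eval X f) = 0"
    if f: "f \<in> FA" and add: "\<And>x y. L (x + y) = L x + L y" and w: "\<And>w. L (W w) = 0"
    for f and L :: "'a \<Rightarrow> 'a"
  proof -
    have L0: "L 0 = 0" using add[of 0 0] by simp
    have neg: "L (- x) = - L x" for x
      using add[of x "- x"] L0 by (simp add: eq_neg_iff_add_eq_0 add.commute)
    have int: "L (of_int c * W u) = 0" for c u
    proof (induction c rule: int_induct[where k = 0])
      case (step2 i)
      have "of_int (i - 1) * W u = of_int i * W u + - W u" by (simp add: algebra_simps)
      then show ?case by (simp only: add neg w step2 minus_zero add_0)
    qed (simp_all add: L0 distrib_right add w)
    interpret fa_hom "fa_eval X" by (rule fa_hom_fa_eval)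
    show ?thesis using f
      by (induction rule: FA_induct)
        (simp_all add: hom_zero hom_add L0 add fa_eval_fmon int flip: W_eq)
  qed
  note lin = br_def algebra_simps
  have 1: "br (br (br (fa_eval X f1) (W u)) (W v)) (W w) = 0" for u v w
    by (rule ext[OF assms(1)]) (simp_all add: br4_W, simp add: lin)
  have 2: "br (br (br (fa_eval X f1) (fa_eval X f2)) (W v)) (W w) = 0" for v w
    by (rule ext[OF assms(2)]) (simp_all add: 1, simp add: lin)
  have 3: "br (br (br (fa_eval X f1) (fa_eval X f2)) (fa_eval X f3)) (W w) = 0" for w
    by (rule ext[OF assms(3)]) (simp_all add: 2, simp add: lin)
  show ?thesis
    by (rule ext[OF assms(4)]) (simp_all add: 3, simp add: lin)
qed

lemma fa_eval_T4: "f \<in> T4 \<Longrightarrow> fa_eval X f = 0"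
proof -
  interpret fa_hom "fa_eval X" by (rule fa_hom_fa_eval)
  assume "f \<in> T4"
  then have "f \<in> FA \<and> fa_eval X f = 0"
    unfolding T4_def
    by (induction rule: ideal_gen.induct)
      (auto simp: hom_zero hom_add hom_neg hom_mul hom_comm4 br4_fa_eval)
  then show ?thesis ..
qed

lemma br_X_X: "br (X a) (X b) = e a * e b * \<Phi>"
  by (simp add: br_def X_X[of a b])

text \<open>Each pair gives \<open>e a * e b * \<Phi>\<close>, and \<open>\<Phi>\<close> passes the
  following \<open>e\<close> factors until \<open>z\<close> absorbs it.\<close>

lemma comm_prod_X:
  "length is = 2 * k + 3 \<Longrightarrow> comm_prod (map X is) = prod_list (map e is) * z"
proof (induction k arbitrary: "is")
  case 0
  then obtain a b c where "is = [a, b, c]"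
    by (auto simp: length_Suc_conv numeral_eq_Suc)
  then show ?case by (simp add: br_X_X) (simp add: br_def \<Phi>_X push)
next
  case (Suc k)
  then obtain a b c d l where l: "is = a # b # c # d # l"
    by (auto simp: length_Suc_conv numeral_eq_Suc)
  have p: "\<Phi> * (prod_list (map e m) * z) = prod_list (map e m) * z" for m
    by (induction m) (simp_all add: \<Phi>_z \<Phi>_e' mult.assoc)
  have "length (c # d # l) = 2 * k + 3" using Suc.prems l by simp
  from Suc.IH[OF this] have "comm_prod (map X (c # d # l)) = prod_list (map e (c # d # l)) * z" .
  then show ?case using p[of "c # d # l"] by (simp add: l mult.assoc br_X_X)
qed

end

text \<open>The intended \<open>\<delta> i\<close> is \<open>e i\<close> times the partial
  derivative by \<open>x i\<close>. The cutoff \<open>N\<close> keeps sums over all larger letters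
  finite.\<close>

locale weyl_grassmann =
  fixes x \<delta> e :: "nat \<Rightarrow> 'a::ring_1" and z :: 'a and N :: nat
  assumes char3: "(3::'a) = 0"
    and x_x: "x i * x j = x j * x i"
    and e_x: "e i * x j = x j * e i" and z_x: "z * x j = x j * z"
    and e_e: "e i * e j = - (e j * e i)" and e_\<delta>: "e i * \<delta> j = - (\<delta> j * e i)"
    and \<delta>_\<delta>: "\<delta> i * \<delta> j = - (\<delta> j * \<delta> i)"
    and z_e: "z * e i = - (e i * z)" and z_\<delta>: "z * \<delta> i = - (\<delta> i * z)"
    and z_z: "z * z = 0" and e_e_0: "e i * e i = 0" and e_\<delta>_0: "e i * \<delta> i = 0"
    and \<delta>_x: "\<delta> j * x i = x i * \<delta> j + (if i = j then e i else 0)"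
    and cutoff: "i \<ge> N \<Longrightarrow> e i = 0 \<and> \<delta> i = 0"
begin

text \<open>\<^term>\<open>X b\<close> is the operator of left multiplication by a letter on normally ordered monomials:
  \<open>C b\<close> collects the commutators that arise when the letter \<open>b\<close> passes smaller letters \<open>j\<close>, and the
  triple commutators that arise when such a commutator passes a letter \<open>k > j\<close>.\<close>

definition A where "A b = (\<Sum>j<b. \<delta> j)"
definition U where "U a = (\<Sum>k\<in>{a<..<N}. \<delta> k)"
definition P where "P b = (\<Sum>j<b. \<delta> j * U j)"
definition C where "C b = e b * A b + e b * (P b * z)"
definition X where "X b = x b + C b"
definition \<Phi> where "\<Phi> = 1 + A N * z"

lemma odd_sums:
  "e i * A b = - (A b * e i)" "z * A b = - (A b * z)" "\<delta> i * A b = - (A b * \<delta> i)"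
  "e i * U b = - (U b * e i)" "z * U b = - (U b * z)" "\<delta> i * U b = - (U b * \<delta> i)"
  unfolding A_def U_def sum_distrib_left sum_distrib_right e_\<delta> z_\<delta> \<delta>_\<delta>[of i] sum_negf
  by simp_all

lemma even_P: assumes "\<And>j. y * \<delta> j = - (\<delta> j * y)" shows "y * P b = P b * y"
proof -
  have "y * U j = - (U j * y)" for j
    unfolding U_def sum_distrib_left sum_distrib_right by (simp add: assms sum_negf)
  then have "y * (\<delta> j * U j) = \<delta> j * U j * y" for j
    using assoc_extend_neg[OF assms, of j "U j"] by (simp add: mult.assoc)
  then show ?thesis unfolding P_def sum_distrib_left sum_distrib_right by simp
qed

text \<open>This form has \<open>\<delta> j\<close> with \<open>j < b\<close> rightmost, where it
  acts first and kills monomials without the letter \<open>j\<close>.\<close>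

lemma P_z: "P b * z = (\<Sum>j<b. U j * (z * \<delta> j))"
proof -
  have "\<delta> j * U j * z = U j * (z * \<delta> j)" for j
    by (simp add: odd_sums(6) z_\<delta> mult.assoc)
  then show ?thesis unfolding P_def by (simp add: sum_distrib_right)
qed

text \<open>\<open>y\<close> stands for an odd element \<open>e i\<close>, \<open>z\<close> or
  \<open>\<delta> i\<close>; both summands of \<open>C b\<close> have an even number of odd
  factors.\<close>

lemma central_C:
  assumes \<delta>: "\<And>j. y * \<delta> j = - (\<delta> j * y)" and e: "\<And>j. y * e j = - (e j * y)"
    and z: "y * z = - (z * y)"
  shows "y * C b = C b * y"
proof -
  have "y * A b = - (A b * y)"
    unfolding A_def sum_distrib_left sum_distrib_right by (simp add: \<delta> sum_negf)
  then have "y * (e b * A b) = e b * (A b * y)"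
    by (simp add: assoc_extend_neg[OF e])
  moreover have "y * (e b * (P b * z)) = e b * (P b * (z * y))"
    by (simp add: assoc_extend_neg[OF e] assoc_extend[OF even_P[OF \<delta>]] z)
  ultimately show ?thesis by (simp add: C_def distrib_left distrib_right mult.assoc)
qed

lemma e_C: "e i * C b = C b * e i"
  by (rule central_C, rule e_\<delta>, rule e_e, simp add: z_e)

lemma z_C: "z * C b = C b * z"
  by (rule central_C, rule z_\<delta>, rule z_e, simp add: z_z)

lemma \<delta>_C: "\<delta> i * C b = C b * \<delta> i"
  by (rule central_C, rule \<delta>_\<delta>, simp_all add: e_\<delta> z_\<delta>)

lemma A_C: "A a * C b = C b * A a"
  unfolding A_def by (simp add: sum_distrib_left sum_distrib_right \<delta>_C)

lemma P_C: "P a * C b = C b * P a"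
proof -
  have "\<delta> j * (U j * C b) = C b * (\<delta> j * U j)" for j
    unfolding U_def
    by (simp add: sum_distrib_left sum_distrib_right \<delta>_C assoc_extend[OF \<delta>_C, symmetric] flip: mult.assoc)
  then show ?thesis
    unfolding P_def by (simp add: sum_distrib_left sum_distrib_right mult.assoc)
qed

lemma C_C: "C a * C b = C b * C a"
  by (simp add: C_def[of a] distrib_left distrib_right mult.assoc A_C P_C z_C
      assoc_extend[OF A_C] assoc_extend[OF P_C] assoc_extend[OF e_C])

lemma A_x: "A b * x a = x a * A b + (if a < b then e a else 0)"
  unfolding A_def by (simp add: sum_distrib_left sum_distrib_right \<delta>_x sum.distrib)

lemma U_x: "U j * x a = x a * U j + (if j < a then e a else 0)"
  unfolding U_def using cutoff[of a]
  by (auto simp add: sum_distrib_left sum_distrib_right \<delta>_x sum.distrib not_less)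

text \<open>\<open>x a\<close> interacts with the left factor when \<open>j = a\<close> and with the
  tail \<open>U j\<close> when \<open>j < a\<close>; in the second case \<open>e a\<close> passes
  \<open>\<delta> j\<close> and changes sign.\<close>

lemma P_x: "P b * x a = x a * P b + (if a < b then e a * U a else 0) - e a * A (min a b)"
proof -
  have "\<delta> j * U j * x a = x a * (\<delta> j * U j) + (if j = a then e a * U a else 0)
      + (if j < a then - (e a * \<delta> j) else 0)" for j
  proof -
    have "\<delta> j * U j * x a = \<delta> j * x a * U j + \<delta> j * (if j < a then e a else 0)"
      by (simp add: mult.assoc U_x distrib_left)
    also have "\<dots> = x a * (\<delta> j * U j) + (if j = a then e a * U a else 0)
        + (if j < a then - (e a * \<delta> j) else 0)"
      by (auto simp: \<delta>_x distrib_right mult.assoc e_\<delta>)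
    finally show ?thesis .
  qed
  then have "P b * x a = x a * P b + (\<Sum>j<b. if j = a then e a * U a else 0)
      + (\<Sum>j<b. if j < a then - (e a * \<delta> j) else 0)"
    unfolding P_def by (simp add: sum_distrib_left sum_distrib_right sum.distrib)
  also have "(\<Sum>j<b. if j < a then - (e a * \<delta> j) else 0) = (\<Sum>j\<in>{..<b} \<inter> {j. j < a}. - (e a * \<delta> j))"
    by (simp add: sum.inter_restrict)
  also have "{..<b} \<inter> {j. j < a} = {..<min a b}" by auto
  also have "(\<Sum>j<min a b. - (e a * \<delta> j)) = - (e a * A (min a b))"
    by (simp add: A_def sum_distrib_left sum_negf)
  finally show ?thesis by simp
qed

lemma C_x: "C b * x a = x a * C b + e b * (if a < b then e a else 0)
    + e b * (((if a < b then e a * U a else 0) - e a * A (min a b)) * z)"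
proof -
  have "C b * x a = e b * (A b * x a) + e b * (P b * x a * z)"
    by (simp add: C_def distrib_right mult.assoc z_x)
  then show ?thesis
    by (simp add: A_x P_x C_def distrib_left distrib_right left_diff_distrib right_diff_distrib
        mult.assoc assoc_extend[OF e_x])
qed

lemma A_N: "a < N \<Longrightarrow> A N = A a + \<delta> a + U a"
proof -
  assume "a < N"
  then have "{..<N} = insert a ({..<a} \<union> {a<..<N})" by auto
  moreover have "sum \<delta> ({..<a} \<union> {a<..<N}) = sum \<delta> {..<a} + sum \<delta> {a<..<N}"
    by (rule sum.union_disjoint) auto
  ultimately show ?thesis unfolding A_def U_def by (simp add: algebra_simps)
qed

text \<open>Here characteristic 3 enters: the coefficient \<open>-2\<close> of \<^term>\<open>A a\<close> equals \<open>1\<close>, so that the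
  sum over the letters below \<^term>\<open>a\<close> and the sum over those above combine to \<^term>\<open>A N\<close>.\<close>

lemma X_X_less:
  assumes "a < b"
  shows "X b * X a = X a * X b + e b * e a * \<Phi>"
proof -
  have "X b * X a - X a * X b = (C b * x a - x a * C b) - (C a * x b - x b * C a)"
    by (simp add: X_def distrib_left distrib_right x_x[of b a] C_C[of b a])
  also have "C b * x a - x a * C b = e b * e a + e b * (e a * ((U a - A a) * z))"
    using assms by (simp add: C_x distrib_left algebra_simps)
  also have "C a * x b - x b * C a = e b * (e a * (A a * z))"
    using assms assoc_extend_neg[OF e_e[of a b], of "A a * z"] by (simp add: C_x mult.assoc)
  also have "e b * e a + e b * (e a * ((U a - A a) * z)) - e b * (e a * (A a * z))
      = e b * e a + e b * (e a * ((U a - A a - A a) * z))"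
    by (simp add: algebra_simps)
  also have "U a - A a - A a = U a + A a"
  proof -
    have "A a + A a + A a = 0" using three_times[of "A a"] by (simp only: char3 mult_zero_left)
    then show ?thesis by (simp add: algebra_simps)
  qed
  also have "e a * ((U a + A a) * z) = e a * (A N * z)"
  proof (cases "a < N")
    case True
    have "e a * (\<delta> a * z) = 0" using e_\<delta>_0[of a] by (simp flip: mult.assoc)
    then show ?thesis by (simp add: A_N[OF True] algebra_simps)
  next
    case False
    then show ?thesis using cutoff[of a] by simp
  qed
  finally have "X b * X a - X a * X b = e b * e a + e b * (e a * (A N * z))" .
  then show ?thesis by (simp add: \<Phi>_def distrib_left mult.assoc algebra_simps)
qed

sublocale cubic_model X e z \<Phi>
proof
  show "X b * X a = X a * X b + e b * e a * \<Phi>" for a b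
  proof (cases a b rule: linorder_cases)
    case greater
    from X_X_less[OF this] show ?thesis using e_e[of a b] by (simp add: mult.assoc)
  qed (simp_all add: X_X_less e_e_0)
  have A_z: "A N * z * C k = C k * (A N * z)" for k
    by (simp add: mult.assoc z_C assoc_extend[OF A_C])
  show "\<Phi> * X k = X k * \<Phi> + e k * z" for k
    using cutoff[of k] A_z[of k]
    by (cases "k < N")
      (simp_all add: \<Phi>_def X_def distrib_left distrib_right mult.assoc z_x assoc_extend[OF z_x] A_x
        flip: mult.assoc[of "A N" "x k"])
  show "\<Phi> * e i = e i * \<Phi>" for i
    by (simp add: \<Phi>_def distrib_left distrib_right mult.assoc z_e assoc_extend_neg[OF odd_sums(1)])
  show "z * \<Phi> = z"
    by (simp add: \<Phi>_def distrib_left assoc_extend_neg[OF odd_sums(2)] z_z)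
  show "\<Phi> * z = z"
    by (simp add: \<Phi>_def distrib_right mult.assoc z_z)
  show "e i * e j = - (e j * e i)" for i j by (rule e_e)
qed (simp_all add: char3 z_e z_z X_def distrib_left distrib_right e_x e_C z_x z_C)

end

section \<open>Operators on polynomials with Grassmann coefficients\<close>

text \<open>As a type of their own, additive maps form a ring under composition to which the locales
  above apply.\<close>

typedef (overloaded) 'v endo = "{T :: 'v::ab_group_add \<Rightarrow> 'v. \<forall>f g. T (f + g) = T f + T g}"
  morphisms app Endo
  by (rule exI[of _ id]) simp

setup_lifting type_definition_endo

lemma app_add: "app T (f + g) = app T f + app T g"
  using app[of T] by simp

lemma app_zero: "app T 0 = 0"
  using app_add[of T 0 0] by simp

instantiation endo :: (ab_group_add) ring
begin
lift_definition zero_endo :: "'a endo" is "\<lambda>_. 0" by simp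
lift_definition plus_endo :: "'a endo \<Rightarrow> 'a endo \<Rightarrow> 'a endo" is "\<lambda>S T f. S f + T f"
  by (simp add: algebra_simps)
lift_definition minus_endo :: "'a endo \<Rightarrow> 'a endo \<Rightarrow> 'a endo" is "\<lambda>S T f. S f - T f"
  by (simp add: algebra_simps)
lift_definition uminus_endo :: "'a endo \<Rightarrow> 'a endo" is "\<lambda>T f. - T f"
  by (simp add: algebra_simps)
lift_definition times_endo :: "'a endo \<Rightarrow> 'a endo \<Rightarrow> 'a endo" is "\<lambda>S T f. S (T f)"
  by simp
instance
  by standard (transfer; simp add: algebra_simps fun_eq_iff)+
end

lemma endo_eqI: "(\<And>f. app S f = app T f) \<Longrightarrow> S = T"
  by (metis app_inject ext)

lemmas app_simps = zero_endo.rep_eq plus_endo.rep_eq minus_endo.rep_eq uminus_endo.rep_eq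
  times_endo.rep_eq

instantiation endo :: ("{ab_group_add, zero_neq_one}") ring_1
begin
lift_definition one_endo :: "'a endo" is "\<lambda>f. f" by simp
instance
proof
  show "(0::'a endo) \<noteq> 1"
    by transfer (metis zero_neq_one)
qed (transfer; simp)+
end

lemma app_one: "app 1 f = f"
  by (simp add: one_endo.rep_eq)

lemma app_sum: "app (\<Sum>i\<in>I. T i) f = (\<Sum>i\<in>I. app (T i) f)"
  by (induction I rule: infinite_finite_induct) (simp_all add: app_simps)

type_synonym fock = "(nat \<Rightarrow> nat) \<times> nat set \<Rightarrow> 3"

text \<open>A vector assigns coefficients to the products of a monomial in commuting variables, given
  by its exponents, and a Grassmann monomial, given by the set of its generators. Generator \<open>0\<close>
  plays the role of \<open>z\<close>.\<close>

lift_definition x_op :: "nat \<Rightarrow> fock endo" is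
  "\<lambda>b f k. if fst k b > 0 then f ((fst k)(b := fst k b - 1), snd k) else 0"
  by (auto simp: fun_eq_iff)

lift_definition d_op :: "nat \<Rightarrow> fock endo" is
  "\<lambda>b f k. of_nat (fst k b + 1) * f ((fst k)(b := fst k b + 1), snd k)"
  by (auto simp: fun_eq_iff distrib_left)

text \<open>The Koszul sign for moving generator \<open>b\<close> to its place past the smaller
  generators.\<close>

definition sgn_below :: "nat \<Rightarrow> nat set \<Rightarrow> 3" where
  "sgn_below b I = (- 1) ^ card {i \<in> I. i < b}"

lift_definition e_op :: "nat \<Rightarrow> fock endo" is
  "\<lambda>b f k. if b \<in> snd k then sgn_below b (snd k) * f (fst k, snd k - {b}) else 0"
  by (auto simp: fun_eq_iff distrib_left)

lemma sgn_below_remove: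
  assumes "b \<in> I" "b < c"
  shows "sgn_below c (I - {b}) = - sgn_below c I"
    and "sgn_below b (I - {c}) = sgn_below b I"
proof -
  have "{i \<in> I. i < c} = insert b {i \<in> I - {b}. i < c}" using assms by auto
  moreover have "finite {i \<in> I - {b}. i < c}" by (rule finite_subset[of _ "{..<c}"]) auto
  ultimately have "card {i \<in> I. i < c} = Suc (card {i \<in> I - {b}. i < c})" by simp
  then show "sgn_below c (I - {b}) = - sgn_below c I" by (simp add: sgn_below_def)
  have "{i \<in> I - {c}. i < b} = {i \<in> I. i < b}" using assms by auto
  then show "sgn_below b (I - {c}) = sgn_below b I" by (simp add: sgn_below_def)
qed

lemma e_op_square: "e_op b * e_op b = 0"
  by (rule endo_eqI) (auto simp: app_simps e_op.rep_eq fun_eq_iff)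

lemma e_op_anticommute: "e_op b * e_op c = - (e_op c * e_op b)"
proof -
  have less: "e_op b * e_op c = - (e_op c * e_op b)" if "b < c" for b c
    using that
    by (intro endo_eqI)
      (auto simp: app_simps e_op.rep_eq fun_eq_iff sgn_below_remove Diff_insert2[symmetric] insert_commute
        algebra_simps)
  show ?thesis
    by (cases b c rule: linorder_cases) (simp_all add: less e_op_square)
qed

lemma x_op_commute: "x_op b * x_op c = x_op c * x_op b"
  by (rule endo_eqI) (auto simp: app_simps x_op.rep_eq fun_eq_iff fun_upd_twist)

lemma d_op_commute: "d_op b * d_op c = d_op c * d_op b"
  by (rule endo_eqI) (auto simp: app_simps d_op.rep_eq fun_eq_iff fun_upd_twist algebra_simps)

lemma e_op_x_op: "e_op b * x_op c = x_op c * e_op b"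
  by (rule endo_eqI) (auto simp: app_simps x_op.rep_eq e_op.rep_eq fun_eq_iff)

lemma e_op_d_op: "e_op b * d_op c = d_op c * e_op b"
  by (rule endo_eqI) (auto simp: app_simps d_op.rep_eq e_op.rep_eq fun_eq_iff algebra_simps)

lemma d_op_x_op: "d_op b * x_op c = x_op c * d_op b + (if b = c then 1 else 0)"
  by (rule endo_eqI)
    (auto simp: app_simps app_one x_op.rep_eq d_op.rep_eq fun_eq_iff fun_upd_twist algebra_simps)

lemma three_eq_0: "(3::3) = 0"
  by simp

lemma endo_char3: "(3::fock endo) = 0"
proof (rule endo_eqI)
  fix f :: fock
  have three: "(3::fock endo) = 1 + 1 + 1" by simp
  have "a + a + a = (0::3)" for a
  proof -
    have "a + a + a = 3 * a" by simp
    then show ?thesis by (simp only: three_eq_0 mult_zero_left)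
  qed
  then have "f + f + f = 0" by (simp only: fun_eq_iff plus_fun_def zero_fun_def) simp
  then show "app 3 f = app 0 f"
    unfolding three by (simp only: app_simps app_one)
qed

text \<open>The shift by \<open>Suc\<close> reserves generator 0 for \<open>z\<close>; the
  truncation supplies the cutoff of \<open>weyl_grassmann\<close>.\<close>

definition e_cut :: "nat \<Rightarrow> nat \<Rightarrow> fock endo" where
  "e_cut N i = (if i < N then e_op (Suc i) else 0)"

lemma weyl_grassmann_fock: "weyl_grassmann x_op (\<lambda>i. e_cut N i * d_op i) (e_cut N) (e_op 0) N"
proof -
  have e_e: "e_cut N i * e_cut N j = - (e_cut N j * e_cut N i)" for i j
    unfolding e_cut_def using e_op_anticommute[of "Suc i" "Suc j"] by auto
  have z_e: "e_op 0 * e_cut N i = - (e_cut N i * e_op 0)" for i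
    unfolding e_cut_def using e_op_anticommute[of 0 "Suc i"] by auto
  have e_d: "e_cut N i * d_op j = d_op j * e_cut N i" for i j
    by (simp add: e_cut_def e_op_d_op)
  have e_x: "e_cut N i * x_op j = x_op j * e_cut N i" for i j
    by (simp add: e_cut_def e_op_x_op)
  have e_e_0: "e_cut N i * e_cut N i = 0" for i
    by (simp add: e_cut_def e_op_square)
  show ?thesis
  proof
    fix i j
    show "e_cut N i * (e_cut N j * d_op j) = - (e_cut N j * d_op j * e_cut N i)"
      using assoc_extend_neg[OF e_e[of i j], of "d_op j"] by (simp only: e_d[of i j] mult.assoc)
    show "e_cut N i * d_op i * (e_cut N j * d_op j) = - (e_cut N j * d_op j * (e_cut N i * d_op i))"
    proof -
      have "e_cut N i * d_op i * (e_cut N j * d_op j) = e_cut N i * (e_cut N j * (d_op i * d_op j))"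
        for i j
        using assoc_extend[OF e_d[symmetric], of i j "d_op j"] by (simp add: mult.assoc)
      then show ?thesis
        using assoc_extend_neg[OF e_e[of i j], of "d_op i * d_op j"] by (simp add: d_op_commute[of i j])
    qed
    show "e_op 0 * (e_cut N i * d_op i) = - (e_cut N i * d_op i * e_op 0)"
      by (simp add: assoc_extend_neg[OF z_e] e_op_d_op mult.assoc)
    show "e_cut N i * (e_cut N i * d_op i) = 0"
      by (simp add: e_e_0 flip: mult.assoc)
    show "e_cut N j * d_op j * x_op i = x_op i * (e_cut N j * d_op j) + (if i = j then e_cut N i else 0)"
      by (simp add: mult.assoc d_op_x_op distrib_left assoc_extend[OF e_x])
  qed (rule x_op_commute e_e | simp add: endo_char3 e_x e_op_x_op z_e e_op_square e_e_0
      | simp add: e_cut_def)+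
qed

section \<open>Action on basis vectors\<close>

definition single :: "3 \<Rightarrow> (nat \<Rightarrow> nat) \<Rightarrow> nat set \<Rightarrow> fock" where
  "single s m I = (\<lambda>k. if k = (m, I) then s else 0)"

lemma x_op_single: "app (x_op b) (single s m I) = single s (m(b := Suc (m b))) I"
proof
  fix k :: "(nat \<Rightarrow> nat) \<times> nat set"
  have "fst k b > 0 \<and> (fst k)(b := fst k b - 1) = m \<longleftrightarrow> fst k = m(b := Suc (m b))"
    by (auto simp: fun_eq_iff)
  then show "app (x_op b) (single s m I) k = single s (m(b := Suc (m b))) I k"
    by (cases k) (auto simp: x_op.rep_eq single_def)
qed

lemma d_op_single: "m b = 0 \<Longrightarrow> app (d_op b) (single s m I) = 0"
  by (auto simp: d_op.rep_eq single_def fun_eq_iff)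

lemma e_op_single:
  assumes "b \<notin> I" "s \<in> {1, - 1}"
  shows "\<exists>s'\<in>{1, - 1}. app (e_op b) (single s m I) = single s' m (insert b I)"
proof
  have "sgn_below b (insert b I) \<in> {1, - 1}"
    unfolding sgn_below_def by (simp add: minus_one_power_iff)
  with assms(2) show "sgn_below b (insert b I) * s \<in> {1, - 1}" by auto
  show "app (e_op b) (single s m I) = single (sgn_below b (insert b I) * s) m (insert b I)"
    using assms(1) by (auto simp: e_op.rep_eq single_def fun_eq_iff)
qed

text \<open>The rightmost letter acts first, so \<open>b\<close> meets a monomial whose letters are
  all at least \<open>b\<close>, whereas \<open>C b\<close> starts by differentiating by a letter
  below \<open>b\<close>. Only multiplication by \<open>x b\<close> survives.\<close>

lemma sorted_word_single:
  fixes N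
  defines "X \<equiv> weyl_grassmann.X x_op (\<lambda>i. e_cut N i * d_op i) (e_cut N) (e_op 0) N"
  assumes "sorted js"
  shows "app (prod_list (map X js)) (single s (\<lambda>_. 0) I) = single s (count (mset js)) I"
  using assms(2)
proof (induction js)
  case Nil
  show ?case by (simp add: app_one zero_fun_def)
next
  case (Cons b js)
  interpret weyl_grassmann x_op "\<lambda>i. e_cut N i * d_op i" "e_cut N" "e_op 0" N
    by (rule weyl_grassmann_fock)
  let ?v = "single s (count (mset js)) I"
  have "app (e_cut N j * d_op j) ?v = 0" if "j < b" for j
  proof -
    have "count (mset js) j = 0" using that Cons.prems by (auto simp: count_eq_zero_iff)
    then show ?thesis by (simp add: app_simps d_op_single app_zero)
  qed
  then have "app (C b) ?v = 0"
    by (simp add: C_def A_def P_z app_simps app_sum app_zero)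
  then have X: "app (X b) ?v = single s (count (mset (b # js))) I"
  proof -
    have "count (mset (b # js)) = (count (mset js))(b := Suc (count (mset js) b))" by auto
    with \<open>app (C b) ?v = 0\<close> show ?thesis
      unfolding assms(1) X_def by (simp only: app_simps x_op_single) simp
  qed
  have "app (prod_list (map X js)) (single s (\<lambda>_. 0) I) = ?v" using Cons by simp
  then show ?case by (simp only: list.map prod_list.Cons times_endo.rep_eq X)
qed

lemma grassmann_single:
  assumes "distinct is" "set is \<subseteq> {..<N}"
  shows "\<exists>s\<in>{1, - 1}. app (prod_list (map (e_cut N) is) * e_op 0) (single 1 m {})
    = single s m (insert 0 (Suc ` set is))"
  using assms
proof (induction "is")
  case Nil
  show ?case using e_op_single[of 0 "{}" 1 m] by simp
next
  case (Cons i "is")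
  then obtain s where s: "s \<in> {1, - 1}"
    "app (prod_list (map (e_cut N) is) * e_op 0) (single 1 m {}) = single s m (insert 0 (Suc ` set is))"
    by auto
  have e: "e_cut N i = e_op (Suc i)" using Cons.prems by (simp add: e_cut_def)
  have "Suc i \<notin> insert 0 (Suc ` set is)" using Cons.prems by auto
  from e_op_single[OF this s(1), of m] show ?case
    using Cons.prems s(2) e by (simp add: app_simps insert_commute)
qed

section \<open>Coefficients modulo 3 and linear independence\<close>

lemma app_of_int_mult: "app (of_int c * T) f k = of_int c * app T (f :: fock) k"
proof (induction c rule: int_induct[where k = 0])
  case base
  show ?case by (simp add: app_simps)
next
  case (step1 i)
  then show ?case by (simp add: distrib_right app_simps)
next
  case (step2 i)
  then show ?case by (simp add: left_diff_distrib app_simps)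
qed

lemma sum_apply: "(\<Sum>i\<in>I. f i) k = (\<Sum>i\<in>I. f i (k::'k) :: 'b::comm_monoid_add)"
  by (induction I rule: infinite_finite_induct) simp_all

lemma of_int_eq_0_dvd:
  assumes "of_int c = (0::3)" shows "3 dvd c"
proof -
  have "(of_int c :: 3) = of_int (3 * (c div 3) + c mod 3)" by simp
  also have "\<dots> = of_int (c mod 3)" 
    by (simp only: of_int_add of_int_mult of_int_numeral three_eq_0 mult_zero_left add_0)
  finally have *: "of_int (c mod 3) = (0::3)" using assms by simp
  have "c mod 3 = 0 \<or> c mod 3 = 1 \<or> c mod 3 = 2" by presburger
  then show ?thesis
  proof (elim disjE)
    assume "c mod 3 = 0"
    then show ?thesis by presburger
  qed (use * in simp_all)
qed

text \<open>On the vacuum each element of \<open>F\<close> gives, up to sign, the basis vector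
  recorded in \<open>?key\<close>. Keys are pairwise distinct, so the coefficient at
  \<open>?key e0\<close> isolates \<open>c e0\<close> modulo 3.\<close>

lemma Eset_independent_mod_T4:
  assumes F: "finite F" "F \<subseteq> Eset" and T4: "lincomb F c \<in> T4" and e0: "e0 \<in> F"
  shows "3 dvd c e0"
proof -
  have "\<forall>e\<in>F. \<exists>js k is. e = Eelt js k is \<and> sorted js \<and> length is = 2 * k + 3 \<and> sorted_wrt (<) is"
    using F(2) unfolding Eset_def by blast
  then obtain J K I where "\<And>e. e \<in> F \<Longrightarrow> e = Eelt (J e) (K e) (I e) \<and> sorted (J e)
      \<and> length (I e) = 2 * K e + 3 \<and> sorted_wrt (<) (I e)"
    by metis
  then have eq: "e = Eelt (J e) (K e) (I e)" and srt: "sorted (J e)"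
    and len: "length (I e) = 2 * K e + 3" and strict: "sorted_wrt (<) (I e)" if "e \<in> F" for e
    using that by blast+
  have "finite (\<Union>e\<in>F. set (I e))" using F(1) by simp
  \<comment> \<open>With \<open>N\<close> above all commutator indices in \<open>F\<close>, none of
    the required \<open>e_cut\<close> factors is truncated.\<close>
  then obtain N where N: "\<And>e. e \<in> F \<Longrightarrow> set (I e) \<subseteq> {..<N}"
    unfolding finite_nat_set_iff_bounded by blast
  interpret weyl_grassmann x_op "\<lambda>i. e_cut N i * d_op i" "e_cut N" "e_op 0" N
    by (rule weyl_grassmann_fock)
  interpret fa_hom "fa_eval X" by (rule fa_hom_fa_eval)
  let ?vac = "single 1 (\<lambda>_. 0) {}"
  let ?key = "\<lambda>e. (count (mset (J e)), insert 0 (Suc ` set (I e)))"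
  have "\<exists>s\<in>{1, - 1}. app (fa_eval X e) ?vac = single s (fst (?key e)) (snd (?key e))" if e: "e \<in> F" for e
  proof -
    let ?G = "prod_list (map (e_cut N) (I e)) * e_op 0"
    have "fa_eval X e = prod_list (map X (J e)) * ?G"
      using hom_Eelt[OF len[OF e], of "J e"]
      unfolding eq[OF e, symmetric] fa_eval_fvar comm_prod_X[OF len[OF e]] .
    moreover obtain s where s: "s \<in> {1, - 1}"
        "app ?G (single 1 (\<lambda>_. 0) {}) = single s (\<lambda>_. 0) (insert 0 (Suc ` set (I e)))"
      using grassmann_single[of "I e" N "\<lambda>_. 0"] strict[OF e] N[OF e] by (auto simp: strict_sorted_iff)
    ultimately show ?thesis
      using sorted_word_single[OF srt[OF e], of N s]
      by (intro bexI[OF _ s(1)]) (simp only: times_endo.rep_eq s(2) fst_conv snd_conv)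
  qed
  then have "\<forall>e\<in>F. \<exists>s. s \<in> {1, - 1} \<and> app (fa_eval X e) ?vac = single s (fst (?key e)) (snd (?key e))"
    by blast
  from bchoice[OF this] obtain s where s: "\<And>e. e \<in> F \<Longrightarrow> s e \<in> {1, - 1}"
      "\<And>e. e \<in> F \<Longrightarrow> app (fa_eval X e) ?vac = single (s e) (fst (?key e)) (snd (?key e))"
    by blast
  \<comment> \<open>A sorted list is determined by its multiset, a strictly increasing one by its
    set, and \<open>K e\<close> by the length of \<open>I e\<close>.\<close>
  have inj: "e = e0" if e: "e \<in> F" and key: "?key e = ?key e0" for e
  proof -
    have m: "mset (J e) = mset (J e0)" using key by (simp add: count_inject)
    have J: "J e = J e0"
      using properties_for_sort[OF m srt[OF e]] properties_for_sort[OF refl srt[OF e0]] by (rule subst)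
    have "insert 0 (Suc ` set (I e)) = insert 0 (Suc ` set (I e0))"
      using key by (simp only: prod.inject)
    moreover have "0 \<notin> Suc ` set (I e)" "0 \<notin> Suc ` set (I e0)" by auto
    ultimately have "Suc ` set (I e) = Suc ` set (I e0)"
      by (metis insert_ident)
    then have "set (I e) = set (I e0)" by (simp add: inj_image_eq_iff)
    then have I: "I e = I e0"
      by (rule strict_sorted_equal[OF strict[OF e0] strict[OF e]])
    have K: "K e = K e0" using len[OF e] len[OF e0] unfolding I by linarith
    have "e = Eelt (J e) (K e) (I e)" by (rule eq[OF e])
    also have "\<dots> = Eelt (J e0) (K e0) (I e0)" by (simp only: J K I)
    also have "\<dots> = e0" by (rule eq[OF e0, symmetric])
    finally show ?thesis .
  qed
  have FA: "F \<subseteq> FA" using F(2) Eset_subset_FA by blast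
  have "0 = app (fa_eval X (lincomb F c)) ?vac (?key e0)"
    using fa_eval_T4[OF T4] by (simp add: app_simps)
  also have "\<dots> = (\<Sum>e\<in>F. of_int (c e) * app (fa_eval X e) ?vac (?key e0))"
    using hom_lincomb[OF F(1) FA, of c] by (simp add: app_sum app_of_int_mult sum_apply)
  also have "\<dots> = (\<Sum>e\<in>F. if e = e0 then of_int (c e0) * s e0 else 0)"
  proof (rule sum.cong)
    fix e assume e: "e \<in> F"
    show "of_int (c e) * app (fa_eval X e) ?vac (?key e0) = (if e = e0 then of_int (c e0) * s e0 else 0)"
      using inj[OF e] s(2)[OF e] by (auto simp: single_def)
  qed simp
  also have "\<dots> = of_int (c e0) * s e0" using F(1) e0 by simp
  finally have "of_int (c e0) = (0::3)" using s(1)[OF e0] by auto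
  then show ?thesis by (rule of_int_eq_0_dvd)
qed

section \<open>The quotient ring\<close>

lemma T4_fmul_left: "f \<in> FA \<Longrightarrow> g \<in> T4 \<Longrightarrow> fmul f g \<in> T4"
  and T4_fmul_right: "f \<in> FA \<Longrightarrow> g \<in> T4 \<Longrightarrow> fmul g f \<in> T4"
  and T4_fadd: "g \<in> T4 \<Longrightarrow> h \<in> T4 \<Longrightarrow> fadd g h \<in> T4"
  and T4_fneg: "g \<in> T4 \<Longrightarrow> fneg g \<in> T4"
  and T4_fzero: "fzero \<in> T4"
  unfolding T4_def
  by (simp_all add: ideal_gen.lmul ideal_gen.rmul ideal_gen.add ideal_gen.neg ideal_gen.zero)

text \<open>Membership in \<open>FA\<close> is built in, which makes this a partial equivalence
  whose domain is the free ring.\<close>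

definition T4_rel :: "fr \<Rightarrow> fr \<Rightarrow> bool" where
  "T4_rel f g \<longleftrightarrow> f \<in> FA \<and> g \<in> FA \<and> fsub f g \<in> T4"

lemma T4_rel_refl: "f \<in> FA \<Longrightarrow> T4_rel f f"
  using T4_fzero by (simp add: T4_rel_def fsub_def fzero_def)

lemma part_equivp_T4_rel: "part_equivp T4_rel"
proof (rule part_equivpI)
  show "\<exists>f. T4_rel f f" using T4_rel_refl[OF fzero_in_FA] by blast
  show "symp T4_rel"
  proof (rule sympI)
    fix f g assume fg: "T4_rel f g"
    have "fsub g f = fneg (fsub f g)" by (simp add: fsub_def fneg_def)
    with fg T4_fneg show "T4_rel g f" by (simp add: T4_rel_def)
  qed
  show "transp T4_rel"
  proof (rule transpI)
    fix f g h assume fg: "T4_rel f g" "T4_rel g h"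
    have "fsub f h = fadd (fsub f g) (fsub g h)" by (simp add: fsub_def fadd_def)
    with fg T4_fadd show "T4_rel f h" by (simp add: T4_rel_def)
  qed
qed

quotient_type T4_quot = fr / partial: T4_rel
  by (rule part_equivp_T4_rel)

lemma T4_rel_mul:
  assumes "T4_rel f f'" "T4_rel g g'"
  shows "T4_rel (fmul f g) (fmul f' g')"
proof -
  have "fsub (fmul f g) (fmul f' g') = fadd (fmul (fsub f f') g) (fmul f' (fsub g g'))"
    unfolding fsub_def fadd_def fmul_def by (simp add: algebra_simps sum_subtractf sum.distrib)
  with assms show ?thesis
    by (simp add: T4_rel_def T4_fadd T4_fmul_left T4_fmul_right)
qed

lemma T4_rel_add:
  assumes "T4_rel f f'" "T4_rel g g'"
  shows "T4_rel (fadd f g) (fadd f' g')"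
proof -
  have "fsub (fadd f g) (fadd f' g') = fadd (fsub f f') (fsub g g')"
    by (simp add: fsub_def fadd_def fun_eq_iff)
  with assms show ?thesis by (simp add: T4_rel_def T4_fadd)
qed

lemma T4_rel_neg:
  assumes "T4_rel f f'" shows "T4_rel (fneg f) (fneg f')"
proof -
  have "fsub (fneg f) (fneg f') = fneg (fsub f f')"
    by (simp add: fsub_def fneg_def fun_eq_iff)
  with assms show ?thesis by (simp add: T4_rel_def T4_fneg)
qed

text \<open>The class \<open>ring_1\<close> demands that 0 and 1 differ in the quotient. The model,
  here with \<open>N = 0\<close>, kills \<open>T4\<close> but sends \<open>fone\<close> to
  1.\<close>

lemma fone_notin_T4: "fone \<notin> T4"
proof
  interpret weyl_grassmann x_op "\<lambda>i. e_cut 0 i * d_op i" "e_cut 0" "e_op 0" 0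
    by (rule weyl_grassmann_fock)
  interpret fa_hom "fa_eval X" by (rule fa_hom_fa_eval)
  assume "fone \<in> T4"
  then show False using fa_eval_T4[of fone] hom_one by simp
qed

lemma fadd_assoc: "fadd (fadd f g) h = fadd f (fadd g h)"
  and fadd_commute: "fadd f g = fadd g f"
  and fadd_fneg_left: "fadd (fneg f) f = fzero"
  by (simp_all add: fadd_def fneg_def fzero_def algebra_simps)

lemma T4_rel_eqI: "f = g \<Longrightarrow> f \<in> FA \<Longrightarrow> T4_rel f g"
  using T4_rel_refl by blast

lemma T4_rel_FA: "T4_rel f g \<Longrightarrow> f \<in> FA \<and> g \<in> FA"
  by (simp add: T4_rel_def)

instantiation T4_quot :: ring_1
begin

lift_definition zero_T4_quot :: T4_quot is fzero by (simp add: T4_rel_refl)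
lift_definition one_T4_quot :: T4_quot is fone by (simp add: T4_rel_refl)
lift_definition plus_T4_quot :: "T4_quot \<Rightarrow> T4_quot \<Rightarrow> T4_quot" is fadd by (rule T4_rel_add)
lift_definition uminus_T4_quot :: "T4_quot \<Rightarrow> T4_quot" is fneg by (rule T4_rel_neg)
lift_definition minus_T4_quot :: "T4_quot \<Rightarrow> T4_quot \<Rightarrow> T4_quot" is fsub
  unfolding fsub_eq by (intro T4_rel_add T4_rel_neg)
lift_definition times_T4_quot :: "T4_quot \<Rightarrow> T4_quot \<Rightarrow> T4_quot" is fmul by (rule T4_rel_mul)

instance
proof
  show "(0::T4_quot) \<noteq> 1"
  proof transfer
    have "fsub fzero fone = fneg fone" by (simp add: fsub_def fzero_def fneg_def)
    moreover have "fneg (fneg fone) = fone" by (simp add: fneg_def)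
    ultimately show "\<not> T4_rel fzero fone"
      using T4_fneg[of "fneg fone"] fone_notin_T4 by (auto simp: T4_rel_def)
  qed
qed (transfer, rule T4_rel_eqI,
    rule fmul_assoc fmul_fone_left fmul_fone_right fmul_fadd_left fmul_fadd_right
      fadd_assoc fadd_commute fadd_fzero fadd_fneg_left fsub_eq,
    auto dest!: T4_rel_FA)+

end

section \<open>The projection onto the quotient and the conclusion\<close>

lemma abs_T4_quot_eq_iff:
  "f \<in> FA \<Longrightarrow> g \<in> FA \<Longrightarrow> abs_T4_quot f = abs_T4_quot g \<longleftrightarrow> fsub f g \<in> T4"
  using Quotient3_rel[OF Quotient3_T4_quot, of f g] T4_rel_refl[of f] T4_rel_refl[of g]
  by (simp add: T4_rel_def)

interpretation T4: lie_nilpotent_hom abs_T4_quot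
proof -
  have surj: "\<exists>f\<in>FA. a = abs_T4_quot f" for a
    using Quotient3_abs_rep[OF Quotient3_T4_quot, of a] Quotient3_rep_reflp[OF Quotient3_T4_quot, of a]
    by (metis T4_rel_FA)
  interpret fa_hom abs_T4_quot
    by standard (simp_all add: plus_T4_quot.abs_eq times_T4_quot.abs_eq one_T4_quot_def T4_rel_refl)
  have "br (br (br a b) c) d = 0" for a b c d :: T4_quot
  proof -
    obtain f g h k where FA: "f \<in> FA" "g \<in> FA" "h \<in> FA" "k \<in> FA"
      and eq: "a = abs_T4_quot f" "b = abs_T4_quot g" "c = abs_T4_quot h" "d = abs_T4_quot k"
      using surj by metis
    have "comm4 f g h k \<in> T4"
      unfolding T4_def by (rule ideal_gen.gen) (use FA in blast)
    moreover have "fsub (comm4 f g h k) fzero = comm4 f g h k" by (simp add: fsub_def fzero_def)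
    ultimately have "abs_T4_quot (comm4 f g h k) = abs_T4_quot fzero"
      using FA by (simp add: abs_T4_quot_eq_iff)
    then show ?thesis by (simp add: hom_comm4[OF FA] hom_zero eq)
  qed
  with surj show "lie_nilpotent_hom abs_T4_quot" by unfold_locales
qed

theorem theorem1p2:
  shows "T4 \<subseteq> T32
    \<and> (\<forall>f\<in>T32. fsmul 3 f \<in> T4)
    \<and> Eset \<subseteq> T32
    \<and> (\<forall>f\<in>T32. \<exists>F c. finite F \<and> F \<subseteq> Eset \<and> fsub f (lincomb F c) \<in> T4)
    \<and> (\<forall>F c. finite F \<and> F \<subseteq> Eset \<and> lincomb F c \<in> T4 \<longrightarrow> (\<forall>e\<in>F. (3::int) dvd c e))"
proof (intro conjI ballI allI impI)
  show "T4 \<subseteq> T32" by (rule T4_subset_T32)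
  show "Eset \<subseteq> T32" by (rule Eset_subset_T32)
next
  fix f assume f: "f \<in> T32"
  then have FA: "f \<in> FA" using T32_subset_FA by blast
  have S: "abs_T4_quot f \<in> T4.S" by (rule T4.hom_T32_in_S[OF f])
  have "abs_T4_quot (fsmul 3 f) = abs_T4_quot fzero" "fsmul 3 f \<in> FA"
    using T4.S_torsion[OF S] T4.hom_smul[OF FA, of 3] by (simp_all add: T4.hom_zero)
  moreover have "fsub (fsmul 3 f) fzero = fsmul 3 f" by (simp add: fsub_def fzero_def)
  ultimately show "fsmul 3 f \<in> T4" by (simp add: abs_T4_quot_eq_iff)
  obtain F c where F: "finite F" "F \<subseteq> Eset" "abs_T4_quot f = abs_T4_quot (lincomb F c)"
    using T4.S_lincomb[OF S] by blast
  moreover have "lincomb F c \<in> FA"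
    using T4.hom_lincomb[OF F(1)] F(2) Eset_subset_FA by blast
  ultimately show "\<exists>F c. finite F \<and> F \<subseteq> Eset \<and> fsub f (lincomb F c) \<in> T4"
    using FA by (metis abs_T4_quot_eq_iff)
next
  fix F c e assume "finite F \<and> F \<subseteq> Eset \<and> lincomb F c \<in> T4" "e \<in> F"
  then show "(3::int) dvd c e" using Eset_independent_mod_T4 by blast
qed

end
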